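(* Let $m\ge n\ge1$, $G=SO_0(m,n)$ with Lie algebra $\mathfrak g=\mathfrak{so}(m,n)$, and let $p$ be an integer with $p\ge1$ and $2p\le m+n$. Then $$\mathrm{Ad}(G)\Big(\bigoplus_{I\in T_{2p}(m+n)}\mathbb C\, W_I\Big)\subset \bigoplus_{I\in T_{2p}(m+n)}\mathbb C\, W_I\quad\text{and}\quad W_p\in\mathcal Z(\mathfrak g),$$ where $\mathcal Z(\mathfrak g)$ denotes the center of the (complexified) universal enveloping algebra $U(\mathfrak g_{\mathbb C})$.
   Context: $I_{m,n}=\mathrm{diag}(1_m,-1_n)$; $SO_0(m,n)$ is the identity component of $\{g\in GL(m+n,\mathbb R): g^tI_{m,n}g=I_{m,n},\det g=1\}$. With $e_{ij}$ the $(m+n)\times(m+n)$ matrix units, $X_{ij}=e_{ji}-e_{ij}$ for $1\le i<j\le m$ or $m+1\le i<j\le m+n$, and $Y_{ij}=e_{ji}+e_{ij}$ for $1\le i\le m<j\le m+n$. For $1\le i<j\le m+n$ put $\overline X_{ij}=X_{ij}$ if $j\le m$ or $i\ge m+1$, and $\overline X_{ij}=-\sqrt{-1}\,Y_{ij}$ if $i\le m<j$. $T_s(m+n)$ is the set of increasing sequences $I=(i_1,\dots,i_s)$ of length $s$ in $\{1,\dots,m+n\}$; $P(I)$ is the set of permutations of $I$ and $\epsilon(\sigma)$ the sign of $\sigma$. For $I\in T_{2p}(m+n)$, $P_+(I)=\{\sigma\in P(I):\sigma(i_{2a-1})<\sigma(i_{2a+1})\ (1\le a\le p-1),\ \sigma(i_{2a-1})<\sigma(i_{2a})\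 (1\le a\le p)\}$. Then $$W_I=\sum_{\sigma\in P_+(I)}\epsilon(\sigma)\overline X_{\sigma(i_1)\sigma(i_2)}\cdots\overline X_{\sigma(i_{2p-1})\sigma(i_{2p})}\in U(\mathfrak g_{\mathbb C}),\qquad W_p=\sum_{J\in T_{2p}(m+n)}W_J^2.$$ *)

theory Defs
  imports
    "HOL-Analysis.Function_Topology"
    "HOL-Algebra.QuotRing"
    "HOL-Library.Poly_Mapping"
    "HOL-Combinatorics.Permutations"
    "Jordan_Normal_Form.Determinant"
    "Jordan_Normal_Form.Gauss_Jordan_Elimination"
begin

section \<open>The free associative algebra over the complex numbers\<close>

text \<open>Words are wrapped in a datatype so that concatenation can serve as the (noncommutative)
  addition of exponents: the product of finitely supported functions on words is then the one of the
  free algebra with basis the words, and \<open>Poly_Mapping.single 0 c\<close> is the scalar \<open>c\<close>.\<close>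

datatype 'a word = Word (letters: "'a list")

instantiation word :: (type) monoid_add
begin

definition zero_word :: "'a word" where
  "zero_word = Word []"

definition plus_word :: "'a word \<Rightarrow> 'a word \<Rightarrow> 'a word" where
  "plus_word v w = Word (letters v @ letters w)"

instance
  by standard (simp_all add: zero_word_def plus_word_def)

end

type_synonym 'a free_poly = "'a word \<Rightarrow>\<^sub>0 complex"

definition scalar :: "complex \<Rightarrow> 'a free_poly" where
  "scalar c = Poly_Mapping.single 0 c"

definition letter :: "'a \<Rightarrow> 'a free_poly" where
  "letter x = Poly_Mapping.single (Word [x]) 1"

definition free_alg :: "'a set \<Rightarrow> 'a free_poly ring" where
  "free_alg L = \<lparr>carrier = {p. \<forall>w\<in>Poly_Mapping.keys p. set (letters w) \<subseteq> L},
                 monoid.mult = (*), one = 1, zero = 0, add = (+)\<rparr>"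

definition free_map :: "('a \<Rightarrow> 'b) \<Rightarrow> 'a free_poly \<Rightarrow> 'b free_poly" where
  "free_map f p = (\<Sum>w\<in>Poly_Mapping.keys p.
     Poly_Mapping.single (Word (map f (letters w))) (Poly_Mapping.lookup p w))"

section \<open>The universal enveloping algebra of a complex matrix Lie algebra\<close>

text \<open>\<open>L\<close> is a complex Lie algebra of square matrices with the commutator as bracket. All elements of
  \<open>L\<close> are taken as generators; the first two families of relations make the generators depend
  linearly on the element (giving the tensor algebra of \<open>L\<close>), the third one is
  \<open>xy - yx = [x,y]\<close>. The ideal is the two-sided one of HOL-Algebra.\<close>

definition uea_rels :: "complex mat set \<Rightarrow> complex mat free_poly set" where
  "uea_rels L =
     {letter (x + y) - letter x - letter y |x y. x \<in> L \<and> y \<in> L} \<union>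
     {letter (c \<cdot>\<^sub>m x) - scalar c * letter x |c x. x \<in> L} \<union>
     {letter x * letter y - letter y * letter x - letter (x * y - y * x) |x y. x \<in> L \<and> y \<in> L}"

definition uea_ideal :: "complex mat set \<Rightarrow> complex mat free_poly set" where
  "uea_ideal L = genideal (free_alg L) (uea_rels L)"

definition uea_class :: "complex mat set \<Rightarrow> complex mat free_poly \<Rightarrow> complex mat free_poly set" where
  "uea_class L p = uea_ideal L +>\<^bsub>free_alg L\<^esub> p"

definition uea :: "complex mat set \<Rightarrow> complex mat free_poly set ring" where
  "uea L = free_alg L Quot uea_ideal L"

definition uea_incl :: "complex mat set \<Rightarrow> complex mat \<Rightarrow> complex mat free_poly set" where
  "uea_incl L x = uea_class L (letter x)"

definition uea_smult ::
    "complex mat set \<Rightarrow> complex \<Rightarrow> complex mat free_poly set \<Rightarrow> complex mat free_poly set" where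
  "uea_smult L c u = uea_class L (scalar c) \<otimes>\<^bsub>uea L\<^esub> u"

text \<open>The endomorphism of the enveloping algebra induced by a Lie algebra endomorphism \<open>f\<close> of
  \<open>L\<close>; for such \<open>f\<close> the set below is a singleton.\<close>

definition uea_map ::
    "complex mat set \<Rightarrow> (complex mat \<Rightarrow> complex mat) \<Rightarrow>
     complex mat free_poly set \<Rightarrow> complex mat free_poly set" where
  "uea_map L f u = the_elem ((\<lambda>p. uea_class L (free_map f p)) ` u)"

definition ring_center :: "('a, 'b) ring_scheme \<Rightarrow> 'a set" where
  "ring_center R = {z \<in> carrier R. \<forall>x\<in>carrier R. z \<otimes>\<^bsub>R\<^esub> x = x \<otimes>\<^bsub>R\<^esub> z}"

definition uea_line ::
    "complex mat set \<Rightarrow> complex mat free_poly set \<Rightarrow> complex mat free_poly set set" where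
  "uea_line L w = {uea_smult L c w |c. True}"

definition family_sum :: "('a, 'b) ring_scheme \<Rightarrow> 'i set \<Rightarrow> ('i \<Rightarrow> 'a set) \<Rightarrow> 'a set" where
  "family_sum R T V = {finsum R v T |v. v \<in> Pi T V}"

definition family_independent :: "('a, 'b) ring_scheme \<Rightarrow> 'i set \<Rightarrow> ('i \<Rightarrow> 'a set) \<Rightarrow> bool" where
  "family_independent R T V \<longleftrightarrow>
     (\<forall>v\<in>Pi T V. finsum R v T = \<zero>\<^bsub>R\<^esub> \<longrightarrow> (\<forall>i\<in>T. v i = \<zero>\<^bsub>R\<^esub>))"

section \<open>The group and its Lie algebra\<close>

definition I_form :: "nat \<Rightarrow> nat \<Rightarrow> real mat" where
  "I_form m n = mat_diag (m + n) (\<lambda>i. if i < m then 1 else - 1)"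

definition SO_group :: "nat \<Rightarrow> nat \<Rightarrow> real mat set" where
  "SO_group m n = {g \<in> carrier_mat (m + n) (m + n).
     transpose_mat g * I_form m n * g = I_form m n \<and> det g = 1}"

definition mat_topology :: "nat \<Rightarrow> real mat topology" where
  "mat_topology N = pullback_topology (carrier_mat N N)
     (\<lambda>A. \<lambda>ij \<in> {..<N} \<times> {..<N}. A $$ ij)
     (product_topology (\<lambda>_. euclideanreal) ({..<N} \<times> {..<N}))"

definition SO_0 :: "nat \<Rightarrow> nat \<Rightarrow> real mat set" where
  "SO_0 m n =
     connected_component_of_set (subtopology (mat_topology (m + n)) (SO_group m n)) (1\<^sub>m (m + n))"

definition so_algebra :: "nat \<Rightarrow> nat \<Rightarrow> real mat set" where
  "so_algebra m n = {X \<in> carrier_mat (m + n) (m + n).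
     transpose_mat X * I_form m n + I_form m n * X = 0\<^sub>m (m + n) (m + n)}"

abbreviation cmat :: "real mat \<Rightarrow> complex mat" where
  "cmat \<equiv> map_mat complex_of_real"

definition so_complex :: "nat \<Rightarrow> nat \<Rightarrow> complex mat set" where
  "so_complex m n = {cmat A + \<i> \<cdot>\<^sub>m cmat B |A B. A \<in> so_algebra m n \<and> B \<in> so_algebra m n}"

definition Ad :: "real mat \<Rightarrow> complex mat \<Rightarrow> complex mat" where
  "Ad g X = cmat g * X * cmat (the (mat_inverse g))"

definition uea_Ad ::
    "nat \<Rightarrow> nat \<Rightarrow> real mat \<Rightarrow> complex mat free_poly set \<Rightarrow> complex mat free_poly set" where
  "uea_Ad m n g = uea_map (so_complex m n) (Ad g)"

section \<open>The elements \<open>W\<^sub>I\<close> and \<open>W\<^sub>p\<close>\<close>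

text \<open>Row and column indices of matrices start at 0, whereas \<open>i\<close>, \<open>j\<close> and the entries of index
  sequences below range over \<open>{1..m + n}\<close>.\<close>

definition mat_unit :: "nat \<Rightarrow> nat \<Rightarrow> nat \<Rightarrow> real mat" where
  "mat_unit N i j = mat N N (\<lambda>(r, c). if r + 1 = i \<and> c + 1 = j then 1 else 0)"

definition X_mat :: "nat \<Rightarrow> nat \<Rightarrow> nat \<Rightarrow> nat \<Rightarrow> real mat" where
  "X_mat m n i j = mat_unit (m + n) j i - mat_unit (m + n) i j"

definition Y_mat :: "nat \<Rightarrow> nat \<Rightarrow> nat \<Rightarrow> nat \<Rightarrow> real mat" where
  "Y_mat m n i j = mat_unit (m + n) j i + mat_unit (m + n) i j"

definition X_bar :: "nat \<Rightarrow> nat \<Rightarrow> nat \<Rightarrow> nat \<Rightarrow> complex mat" where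
  "X_bar m n i j =
     (if j \<le> m \<or> m + 1 \<le> i then cmat (X_mat m n i j) else (- \<i>) \<cdot>\<^sub>m cmat (Y_mat m n i j))"

definition T_seq :: "nat \<Rightarrow> nat \<Rightarrow> nat list set" where
  "T_seq s N = {I. length I = s \<and> sorted_wrt (<) I \<and> set I \<subseteq> {1..N}}"

text \<open>\<open>I ! (2 * a)\<close> and \<open>I ! (2 * a + 1)\<close> are the entries \<open>i\<close> number \<open>2a + 1\<close> and \<open>2a + 2\<close>,
  with \<open>a\<close> starting at 0.\<close>

definition P_plus :: "nat \<Rightarrow> nat list \<Rightarrow> (nat \<Rightarrow> nat) set" where
  "P_plus p I = {\<sigma>. \<sigma> permutes set I \<and>
     (\<forall>a. a + 1 < p \<longrightarrow> \<sigma> (I ! (2 * a)) < \<sigma> (I ! (2 * (a + 1)))) \<and>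
     (\<forall>a<p. \<sigma> (I ! (2 * a)) < \<sigma> (I ! (2 * a + 1)))}"

definition W_prod :: "nat \<Rightarrow> nat \<Rightarrow> nat \<Rightarrow> nat list \<Rightarrow> (nat \<Rightarrow> nat) \<Rightarrow> complex mat free_poly set" where
  "W_prod m n p I \<sigma> =
     foldr (\<lambda>a u. uea_incl (so_complex m n) (X_bar m n (\<sigma> (I ! (2 * a))) (\<sigma> (I ! (2 * a + 1))))
                    \<otimes>\<^bsub>uea (so_complex m n)\<^esub> u)
       [0..<p] \<one>\<^bsub>uea (so_complex m n)\<^esub>"

definition W_elem :: "nat \<Rightarrow> nat \<Rightarrow> nat \<Rightarrow> nat list \<Rightarrow> complex mat free_poly set" where
  "W_elem m n p I =
     (\<Oplus>\<^bsub>uea (so_complex m n)\<^esub> \<sigma> \<in> P_plus p I.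
        uea_smult (so_complex m n) (of_int (sign \<sigma>)) (W_prod m n p I \<sigma>))"

definition W_sum :: "nat \<Rightarrow> nat \<Rightarrow> nat \<Rightarrow> complex mat free_poly set" where
  "W_sum m n p =
     (\<Oplus>\<^bsub>uea (so_complex m n)\<^esub> J \<in> T_seq (2 * p) (m + n).
        W_elem m n p J \<otimes>\<^bsub>uea (so_complex m n)\<^esub> W_elem m n p J)"

definition W_space :: "nat \<Rightarrow> nat \<Rightarrow> nat \<Rightarrow> complex mat free_poly set set" where
  "W_space m n p = family_sum (uea (so_complex m n)) (T_seq (2 * p) (m + n))
     (\<lambda>I. uea_line (so_complex m n) (W_elem m n p I))"

end

theory Submission
  imports Defs
begin

text \<open>Rescaling the last \<open>n\<close> basis vectors by \<open>- \<i>\<close> gives a basis \<open>f\<^sub>1, f\<^sub>2, \<dots>\<close> of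
\<open>V = \<complex>\<^bsup>m+n\<^esup>\<close> that is orthonormal for the complexified form, and the matrices \<open>X_bar i j\<close> become the bivectors
\<open>f\<^sub>i \<and> f\<^sub>j\<close> in \<open>\<Lambda>\<^sup>2 V\<close>, which is the complexified Lie algebra. A group element acts on a
bivector by \<open>Ad g (u \<and> v) = gu \<and> gv\<close> and an element of the Lie algebra by the Leibniz rule
(\<open>Ad_omega\<close>, \<open>omega_bracket\<close>).

To a tuple of vectors \<open>v\<^sub>0, \<dots>, v\<^bsub>2p-1\<^esub>\<close> attach the Pfaffian
\<open>\<Sum>\<^sub>\<tau> sgn \<tau> \<Prod>\<^sub>a v\<^bsub>\<tau>(2a)\<^esub> \<and> v\<^bsub>\<tau>(2a+1)\<^esub>\<close>, the sum
running over all permutations \<open>\<tau>\<close> of the \<open>2p\<close> positions and the product being taken in the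
enveloping algebra. It is linear in every slot, it is alternating because the sum is
antisymmetrised, and both actions on it are the diagonal ones on the slots (\<open>free_map_pfaffian\<close>,
\<open>pfaffian_bracket\<close>). Up to a nonzero integer factor, \<open>W\<^sub>I\<close> is the Pfaffian of the basis vectors
with indices in \<open>I\<close> (\<open>pfaffian_eq_W_rep\<close>): the summand of \<open>\<tau>\<close> does not change when the two
entries of a factor or two neighbouring factors are exchanged, as bivectors without common index
commute, and the elements of \<open>P\<^sub>+(I)\<close> represent the cosets of the group generated by these
exchanges. The three claims follow from this description.

\<^item> Invariance (\<open>W_space_invariant\<close>): \<open>Ad g\<close> sends the Pfaffian of \<open>f\<^sub>i\<close>, \<open>i \<in> I\<close>, to that of the
  vectors \<open>g f\<^sub>i\<close>. Expanding slot by slot gives Pfaffians of tuples of basis vectors; such a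
  Pfaffian vanishes if an index is repeated and is a multiple of some \<open>W\<^sub>J\<close> otherwise.
\<^item> Centrality (\<open>W_sum_central\<close>): \<open>W\<^sub>p\<close> is proportional to the sum of the squares of the Pfaffians
  of all tuples \<open>K\<close> of indices. In the commutator of this sum with \<open>X\<close>, the index \<open>K\<^sub>b\<close> is replaced
  by \<open>k\<close> with a coefficient antisymmetric in \<open>K\<^sub>b\<close> and \<open>k\<close>, in front of an anticommutator symmetric
  in the old and the new tuple. Exchanging \<open>K\<^sub>b\<close> and \<open>k\<close> shows that the commutator is its own
  negative.
\<^item> Directness of the sum (\<open>W_family_independent\<close>): the reflection in the \<open>i\<close>-th coordinate
  multiplies \<open>W\<^sub>I\<close> by \<open>- 1\<close> if \<open>i \<in> I\<close> and fixes it otherwise, so distinct \<open>I\<close> belong to distinct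
  joint eigenvalues of these reflections.\<close>

section \<open>The free algebra\<close>

lemma scalar_zero [simp]: "scalar 0 = 0"
  by (simp add: scalar_def)

lemma scalar_one [simp]: "scalar 1 = 1"
  by (simp add: scalar_def)

lemma scalar_mult: "scalar c * scalar d = scalar (c * d)"
  by (simp add: scalar_def mult_single)

lemma scalar_add: "scalar (c + d) = scalar c + scalar d"
  by (simp add: scalar_def single_add)

lemma scalar_uminus: "scalar (- c) = - scalar c"
  by (simp add: scalar_def single_uminus)

lemma scalar_of_nat: "scalar (of_nat k) = of_nat k"
  by (simp add: scalar_def)

lemma free_poly_expand:
  fixes p :: "'a free_poly"
  shows "p = (\<Sum>w\<in>Poly_Mapping.keys p. Poly_Mapping.single w (Poly_Mapping.lookup p w))"
  by (rule poly_mapping_eqI) (simp add: lookup_sum lookup_single when_def in_keys_iff)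

text \<open>Additive properties need only be checked on monomials; restricting them to the words of \<open>p\<close>
  keeps track of the alphabet.\<close>

lemma free_poly_induct [case_names single add zero]:
  fixes p :: "'a free_poly"
  assumes "\<And>w c. w \<in> Poly_Mapping.keys p \<Longrightarrow> P (Poly_Mapping.single w c)"
    and "\<And>q r. P q \<Longrightarrow> P r \<Longrightarrow> P (q + r)" and "P 0"
  shows "P p"
proof -
  have "P (\<Sum>w\<in>A. Poly_Mapping.single w (Poly_Mapping.lookup p w))"
    if "A \<subseteq> Poly_Mapping.keys p" for A
    using finite_subset[OF that finite_keys] that
    by (induction A rule: finite_induct) (auto intro: assms)
  from this[of "Poly_Mapping.keys p"] show ?thesis
    using free_poly_expand[of p] by simp
qed

lemma scalar_commute: "scalar c * p = p * scalar c" for p :: "'a free_poly"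
  by (induction p rule: free_poly_induct)
    (auto simp: scalar_def mult_single algebra_simps)

lemma mult_scalar_left: "p * (scalar c * q) = scalar c * (p * q)" for p :: "'a free_poly"
  by (metis mult.assoc scalar_commute)

lemma scalar_mult_both: "(scalar a * x) * (scalar b * y) = scalar (a * b) * (x * y)"
  for x y :: "'a free_poly"
  by (metis mult.assoc mult_scalar_left scalar_mult)

lemma free_map_superset:
  assumes "finite A" "Poly_Mapping.keys p \<subseteq> A"
  shows "free_map f p =
    (\<Sum>w\<in>A. Poly_Mapping.single (Word (map f (letters w))) (Poly_Mapping.lookup p w))"
  unfolding free_map_def
  by (rule sum.mono_neutral_left) (use assms in \<open>auto simp: in_keys_iff\<close>)

lemma free_map_single:
  "free_map f (Poly_Mapping.single w c) = Poly_Mapping.single (Word (map f (letters w))) c"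
  by (subst free_map_superset[of "{w}"]) auto

lemma free_map_zero [simp]: "free_map f 0 = 0"
  by (simp add: free_map_def)

lemma free_map_add: "free_map f (p + q) = free_map f p + free_map f q"
proof -
  let ?A = "Poly_Mapping.keys p \<union> Poly_Mapping.keys q"
  have "Poly_Mapping.keys (p + q) \<subseteq> ?A"
    by (rule keys_add)
  then show ?thesis
    by (simp add: free_map_superset[of ?A] lookup_add single_add sum.distrib)
qed

lemma free_map_uminus: "free_map f (- p) = - free_map f p"
  using free_map_add[of f p "- p"] by (simp add: eq_neg_iff_add_eq_0 add.commute)

lemma free_map_diff: "free_map f (p - q) = free_map f p - free_map f q"
  using free_map_add[of f p "- q"] by (simp add: free_map_uminus)

lemma free_map_sum: "free_map f (\<Sum>i\<in>A. g i) = (\<Sum>i\<in>A. free_map f (g i))"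
  by (induction A rule: infinite_finite_induct) (auto simp: free_map_add)

lemma free_map_mult: "free_map f (p * q) = free_map f p * free_map f q"
proof (induction p rule: free_poly_induct)
  case (single v c)
  show ?case
    by (induction q rule: free_poly_induct)
      (auto simp: free_map_add distrib_left mult_single free_map_single plus_word_def)
qed (auto simp: free_map_add distrib_right)

lemma free_map_scalar [simp]: "free_map f (scalar c) = scalar c"
  by (simp add: scalar_def free_map_single zero_word_def)

lemma free_map_one [simp]: "free_map f 1 = 1"
  using free_map_scalar[of f 1] by simp

lemma free_map_letter [simp]: "free_map f (letter x) = letter (f x)"
  by (simp add: letter_def free_map_single)

lemma single_word_Cons:
  "Poly_Mapping.single (Word (x # xs)) c = letter x * Poly_Mapping.single (Word xs) c"
  by (simp add: letter_def mult_single plus_word_def)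

lemma carrier_free_alg:
  "p \<in> carrier (free_alg L) \<longleftrightarrow> (\<forall>w\<in>Poly_Mapping.keys p. set (letters w) \<subseteq> L)"
  by (simp add: free_alg_def)

lemma free_alg_simps [simp]:
  "p \<otimes>\<^bsub>free_alg L\<^esub> q = p * q" "p \<oplus>\<^bsub>free_alg L\<^esub> q = p + q"
  "\<one>\<^bsub>free_alg L\<^esub> = 1" "\<zero>\<^bsub>free_alg L\<^esub> = 0"
  by (simp_all add: free_alg_def)

lemma free_alg_scalar [simp, intro]: "scalar c \<in> carrier (free_alg L)"
  by (simp add: carrier_free_alg scalar_def zero_word_def)

lemma free_alg_zero [simp, intro]: "0 \<in> carrier (free_alg L)"
  by (simp add: carrier_free_alg)

lemma free_alg_one [simp, intro]: "1 \<in> carrier (free_alg L)"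
  using free_alg_scalar[of 1] by simp

lemma free_alg_letter [intro]: "x \<in> L \<Longrightarrow> letter x \<in> carrier (free_alg L)"
  by (simp add: carrier_free_alg letter_def)

lemma free_alg_add [intro]:
  "p \<in> carrier (free_alg L) \<Longrightarrow> q \<in> carrier (free_alg L) \<Longrightarrow> p + q \<in> carrier (free_alg L)"
  using keys_add[of p q] by (fastforce simp: carrier_free_alg)

lemma free_alg_mult [intro]:
  "p \<in> carrier (free_alg L) \<Longrightarrow> q \<in> carrier (free_alg L) \<Longrightarrow> p * q \<in> carrier (free_alg L)"
  using keys_mult[of p q] by (fastforce simp: carrier_free_alg plus_word_def)

lemma free_alg_uminus [intro]:
  "p \<in> carrier (free_alg L) \<Longrightarrow> - p \<in> carrier (free_alg L)"
  by (auto simp: carrier_free_alg in_keys_iff)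

lemma free_alg_diff [intro]:
  "p \<in> carrier (free_alg L) \<Longrightarrow> q \<in> carrier (free_alg L) \<Longrightarrow> p - q \<in> carrier (free_alg L)"
  using free_alg_add[OF _ free_alg_uminus, of p L q] by simp

lemma free_alg_sum [intro]:
  "(\<And>i. i \<in> A \<Longrightarrow> g i \<in> carrier (free_alg L)) \<Longrightarrow> (\<Sum>i\<in>A. g i) \<in> carrier (free_alg L)"
  by (induction A rule: infinite_finite_induct) auto

lemma free_map_carrier:
  assumes "p \<in> carrier (free_alg L)" "f ` L \<subseteq> M"
  shows "free_map f p \<in> carrier (free_alg M)"
  unfolding free_map_def
proof (rule free_alg_sum)
  fix w assume "w \<in> Poly_Mapping.keys p"
  then show "Poly_Mapping.single (Word (map f (letters w))) (Poly_Mapping.lookup p w)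
      \<in> carrier (free_alg M)"
    using assms by (force simp: carrier_free_alg)
qed

lemma ring_free_alg: "ring (free_alg L)"
proof (rule ringI)
  show "abelian_group (free_alg L)"
    by (rule abelian_groupI)
      (auto simp: add.assoc add.commute intro: exI[of _ "- x" for x] bexI[OF _ free_alg_uminus])
  show "Group.monoid (free_alg L)"
    by (rule monoidI) (auto simp: mult.assoc)
qed (auto simp: algebra_simps)

section \<open>Congruences in the enveloping algebra\<close>

locale matrix_lie_algebra =
  fixes L :: "complex mat set" and N :: nat
  assumes L_carrier: "L \<subseteq> carrier_mat N N"
    and L_add: "x \<in> L \<Longrightarrow> y \<in> L \<Longrightarrow> x + y \<in> L"
    and L_smult: "x \<in> L \<Longrightarrow> c \<cdot>\<^sub>m x \<in> L"
    and L_bracket: "x \<in> L \<Longrightarrow> y \<in> L \<Longrightarrow> x * y - y * x \<in> L"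
begin

abbreviation C where "C \<equiv> carrier (free_alg L)"

lemma uea_rels_carrier: "uea_rels L \<subseteq> C"
  by (auto simp: uea_rels_def intro!: L_add L_smult L_bracket)

lemma ideal_uea_ideal: "ideal (uea_ideal L) (free_alg L)"
  unfolding uea_ideal_def by (rule ring.genideal_ideal[OF ring_free_alg uea_rels_carrier])

sublocale uideal: ideal "uea_ideal L" "free_alg L"
  by (rule ideal_uea_ideal)

sublocale U: ring "uea L"
  unfolding uea_def by (rule uideal.quotient_is_ring)

sublocale class_hom: ring_hom_ring "free_alg L" "uea L" "uea_class L"
proof -
  have "uea_class L = (+>\<^bsub>free_alg L\<^esub>) (uea_ideal L)"
    by (simp add: uea_class_def fun_eq_iff)
  then show "ring_hom_ring (free_alg L) (uea L) (uea_class L)"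
    unfolding uea_def using uideal.rcos_ring_hom_ring by simp
qed

text \<open>All computations in the enveloping algebra take place on representatives, modulo this
  congruence; representatives live in a type of class \<open>ring_1\<close>, so big sums and the usual
  ring identities are available for them.\<close>

definition ucong (infix "\<approx>\<^sub>U" 50) where
  "p \<approx>\<^sub>U q \<longleftrightarrow> p \<in> C \<and> q \<in> C \<and> p - q \<in> uea_ideal L"

lemma ucong_carrier: "p \<approx>\<^sub>U q \<Longrightarrow> p \<in> C" "p \<approx>\<^sub>U q \<Longrightarrow> q \<in> C"
  by (simp_all add: ucong_def)

lemma uea_ideal_uminus: "p \<in> uea_ideal L \<Longrightarrow> - p \<in> uea_ideal L"
  using uideal.I_l_closed[of p "scalar (-1)"] free_alg_scalar[of "-1" L] by (simp add: scalar_uminus)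

lemma uea_ideal_zero: "0 \<in> uea_ideal L"
  using additive_subgroup.zero_closed[OF uideal.is_additive_subgroup] by simp

lemma uea_ideal_add: "p \<in> uea_ideal L \<Longrightarrow> q \<in> uea_ideal L \<Longrightarrow> p + q \<in> uea_ideal L"
  using additive_subgroup.a_closed[OF uideal.is_additive_subgroup, of p q] by simp

lemma ucong_refl: "p \<in> C \<Longrightarrow> p \<approx>\<^sub>U p"
  by (simp add: ucong_def uea_ideal_zero)

lemma ucong_sym: "p \<approx>\<^sub>U q \<Longrightarrow> q \<approx>\<^sub>U p"
  using uea_ideal_uminus[of "p - q"] by (simp add: ucong_def)

lemma ucong_trans [trans]: "p \<approx>\<^sub>U q \<Longrightarrow> q \<approx>\<^sub>U r \<Longrightarrow> p \<approx>\<^sub>U r"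
  using uea_ideal_add[of "p - q" "q - r"] by (simp add: ucong_def)

lemma ucong_eq_trans [trans]: "p \<approx>\<^sub>U q \<Longrightarrow> q = r \<Longrightarrow> p \<approx>\<^sub>U r"
  "p = q \<Longrightarrow> q \<approx>\<^sub>U r \<Longrightarrow> p \<approx>\<^sub>U r"
  by simp_all

lemma ucong_add: "p \<approx>\<^sub>U q \<Longrightarrow> r \<approx>\<^sub>U s \<Longrightarrow> p + r \<approx>\<^sub>U q + s"
  using uea_ideal_add[of "p - q" "r - s"] by (auto simp: ucong_def algebra_simps)

lemma ucong_uminus: "p \<approx>\<^sub>U q \<Longrightarrow> - p \<approx>\<^sub>U - q"
  using uea_ideal_uminus[of "p - q"] by (auto simp: ucong_def)

lemma ucong_diff: "p \<approx>\<^sub>U q \<Longrightarrow> r \<approx>\<^sub>U s \<Longrightarrow> p - r \<approx>\<^sub>U q - s"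
  using ucong_add[OF _ ucong_uminus, of p q r s] by simp

lemma ucong_mult:
  assumes "p \<approx>\<^sub>U q" "r \<approx>\<^sub>U s" shows "p * r \<approx>\<^sub>U q * s"
proof -
  have "p * r - q * s = (p - q) * r + q * (r - s)"
    by (simp add: algebra_simps)
  moreover have "(p - q) * r \<in> uea_ideal L" "q * (r - s) \<in> uea_ideal L"
    using assms uideal.I_r_closed[of "p - q" r] uideal.I_l_closed[of "r - s" q]
    by (auto simp: ucong_def)
  ultimately show ?thesis
    using assms uea_ideal_add by (auto simp: ucong_def)
qed

lemma ucong_sum: "(\<And>i. i \<in> A \<Longrightarrow> g i \<approx>\<^sub>U h i) \<Longrightarrow> (\<Sum>i\<in>A. g i) \<approx>\<^sub>U (\<Sum>i\<in>A. h i)"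
  by (induction A rule: infinite_finite_induct) (auto intro: ucong_add ucong_refl)

lemma ucong_scalar: "p \<approx>\<^sub>U q \<Longrightarrow> scalar c * p \<approx>\<^sub>U scalar c * q"
  by (rule ucong_mult) (auto intro: ucong_refl)

text \<open>Division by 2, in the form in which antisymmetry arguments use it.\<close>

lemma ucong_neg_self:
  assumes "p \<approx>\<^sub>U - p" shows "p \<approx>\<^sub>U 0"
proof -
  have "scalar (1/2) * (p - - p) \<approx>\<^sub>U scalar (1/2) * (p - p)"
    using assms ucong_carrier(1)[OF assms]
    by (intro ucong_scalar ucong_diff ucong_refl ucong_sym[OF assms])
  moreover have "scalar (1/2) * (p - - p) = scalar (1/2) * (scalar 2 * p)"
    using scalar_of_nat[of 2, where 'a = "complex mat"] by (simp add: mult_2)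
  moreover have "\<dots> = p"
    by (simp add: mult.assoc[symmetric] scalar_mult)
  ultimately show ?thesis by simp
qed

lemma ucong_of_diff_zero: "p - q \<approx>\<^sub>U 0 \<Longrightarrow> q \<in> C \<Longrightarrow> p \<approx>\<^sub>U q"
  using ucong_add[OF _ ucong_refl, of "p - q" 0 q] by simp

text \<open>The two eigenvectors of an involution with eigenvalues \<open>1\<close> and \<open>- 1\<close> vanish as soon as their
  sum does: the difference is the image of the sum.\<close>

lemma ucong_zero_of_sum_diff:
  assumes "x \<in> C" "y \<in> C" and sum: "x + y \<approx>\<^sub>U 0" and diff: "x + - y \<approx>\<^sub>U 0"
  shows "x \<approx>\<^sub>U 0" and "y \<approx>\<^sub>U 0"
proof -
  have xy: "x \<approx>\<^sub>U y"
    by (rule ucong_of_diff_zero) (use diff assms(2) in simp_all)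
  have "x \<approx>\<^sub>U - y"
    by (rule ucong_of_diff_zero) (use sum assms(2) in \<open>simp_all add: free_alg_uminus\<close>)
  from ucong_trans[OF ucong_sym[OF xy] this] show y: "y \<approx>\<^sub>U 0"
    by (rule ucong_neg_self)
  show "x \<approx>\<^sub>U 0" by (rule ucong_trans[OF xy y])
qed

lemma uea_class_eq_iff:
  assumes "p \<in> C" "q \<in> C" shows "uea_class L p = uea_class L q \<longleftrightarrow> p \<approx>\<^sub>U q"
proof -
  have m: "a_minus (free_alg L) p q = p - q"
    using assms uideal.minus_equality[of "- q" q]
    by (auto simp: a_minus_def)
  show ?thesis
    using assms uideal.quotient_eq_iff_same_a_r_cos[OF ideal_uea_ideal assms] m
    by (simp add: ucong_def uea_class_def)
qed

lemma uea_class_cong: "p \<approx>\<^sub>U q \<Longrightarrow> uea_class L p = uea_class L q"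
  using uea_class_eq_iff[OF ucong_carrier] by simp

lemma mem_uea_class_iff: "p \<in> C \<Longrightarrow> q \<in> uea_class L p \<longleftrightarrow> q \<approx>\<^sub>U p"
proof
  assume p: "p \<in> C" and "q \<in> uea_class L p"
  then obtain h where h: "h \<in> uea_ideal L" "q = h + p"
    by (auto simp: uea_class_def a_r_coset_def')
  then show "q \<approx>\<^sub>U p"
    using p uideal.a_Hcarr[OF h(1)] by (auto simp: ucong_def)
next
  assume "p \<in> C" "q \<approx>\<^sub>U p"
  then have "q - p \<in> uea_ideal L" "q = (q - p) + p" by (auto simp: ucong_def)
  then show "q \<in> uea_class L p"
    unfolding uea_class_def a_r_coset_def' by force
qed

lemma uea_carrierE:
  assumes "u \<in> carrier (uea L)" obtains p where "p \<in> C" "u = uea_class L p"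
  using assms by (auto simp: uea_def FactRing_def A_RCOSETS_def' uea_class_def)

lemma uea_class_add: "p \<in> C \<Longrightarrow> q \<in> C \<Longrightarrow> uea_class L p \<oplus>\<^bsub>uea L\<^esub> uea_class L q = uea_class L (p + q)"
  using class_hom.hom_add[of p q] by simp

lemma uea_class_mult: "p \<in> C \<Longrightarrow> q \<in> C \<Longrightarrow> uea_class L p \<otimes>\<^bsub>uea L\<^esub> uea_class L q = uea_class L (p * q)"
  using class_hom.hom_mult[of p q] by simp

lemma uea_smult_class: "p \<in> C \<Longrightarrow> uea_smult L c (uea_class L p) = uea_class L (scalar c * p)"
  by (simp add: uea_smult_def uea_class_mult)

lemma uea_class_zero: "uea_class L 0 = \<zero>\<^bsub>uea L\<^esub>"
  using class_hom.hom_zero by simp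

lemma uea_class_one: "uea_class L 1 = \<one>\<^bsub>uea L\<^esub>"
  using class_hom.hom_one by simp

lemma uea_class_finsum:
  assumes "\<And>i. i \<in> A \<Longrightarrow> g i \<in> C"
  shows "(\<Oplus>\<^bsub>uea L\<^esub> i \<in> A. uea_class L (g i)) = uea_class L (\<Sum>i\<in>A. g i)"
  using assms
  by (induction A rule: infinite_finite_induct)
    (auto simp: Pi_def uea_class_zero[symmetric] uea_class_add free_alg_sum)

lemma uea_rels_ideal: "r \<in> uea_rels L \<Longrightarrow> r \<in> uea_ideal L"
  using uideal.genideal_self[OF uea_rels_carrier] by (auto simp: uea_ideal_def)

lemma letter_add:
  assumes "x \<in> L" "y \<in> L" shows "letter (x + y) \<approx>\<^sub>U letter x + letter y"
proof -
  have "letter (x + y) - letter x - letter y \<in> uea_ideal L"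
    by (rule uea_rels_ideal, unfold uea_rels_def) (use assms in blast)
  then show ?thesis using assms by (auto simp: ucong_def diff_diff_eq intro!: L_add)
qed

lemma letter_smult:
  assumes "x \<in> L" shows "letter (c \<cdot>\<^sub>m x) \<approx>\<^sub>U scalar c * letter x"
proof -
  have "letter (c \<cdot>\<^sub>m x) - scalar c * letter x \<in> uea_ideal L"
    by (rule uea_rels_ideal, unfold uea_rels_def) (use assms in blast)
  then show ?thesis using assms by (auto simp: ucong_def intro!: L_smult)
qed

lemma letter_bracket:
  assumes "x \<in> L" "y \<in> L"
  shows "letter x * letter y - letter y * letter x \<approx>\<^sub>U letter (x * y - y * x)"
proof -
  have "letter x * letter y - letter y * letter x - letter (x * y - y * x) \<in> uea_ideal L"
    by (rule uea_rels_ideal, unfold uea_rels_def) (use assms in blast)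
  then show ?thesis
    using assms
    by (simp add: ucong_def free_alg_diff free_alg_mult free_alg_letter L_bracket)
qed

lemma letter_zero: "x \<in> L \<Longrightarrow> letter (0\<^sub>m N N) \<approx>\<^sub>U 0"
proof -
  assume x: "x \<in> L"
  then have "0 \<cdot>\<^sub>m x = 0\<^sub>m N N"
    using L_carrier by (intro eq_matI) auto
  then show ?thesis using letter_smult[OF x, of 0] by simp
qed

definition lie_endo where
  "lie_endo f \<longleftrightarrow> f ` L \<subseteq> L \<and> (\<forall>x\<in>L. \<forall>y\<in>L. f (x + y) = f x + f y)
     \<and> (\<forall>c. \<forall>x\<in>L. f (c \<cdot>\<^sub>m x) = c \<cdot>\<^sub>m f x)
     \<and> (\<forall>x\<in>L. \<forall>y\<in>L. f (x * y - y * x) = f x * f y - f y * f x)"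

lemma lie_endoD:
  assumes "lie_endo f" "x \<in> L" "y \<in> L"
  shows "f x \<in> L" "f (x + y) = f x + f y" "f (c \<cdot>\<^sub>m x) = c \<cdot>\<^sub>m f x"
    "f (x * y - y * x) = f x * f y - f y * f x"
  using assms by (auto simp: lie_endo_def)

lemma free_map_lie_endo_carrier: "lie_endo f \<Longrightarrow> p \<in> C \<Longrightarrow> free_map f p \<in> C"
  by (rule free_map_carrier) (auto simp: lie_endo_def)

text \<open>A Lie algebra endomorphism preserves the defining relations, hence the ideal that they
  generate: the preimage of the ideal is an ideal containing the relations.\<close>

lemma free_map_uea_ideal:
  assumes f: "lie_endo f" and p: "p \<in> uea_ideal L"
  shows "free_map f p \<in> uea_ideal L"
proof -
  let ?J = "{q \<in> C. free_map f q \<in> uea_ideal L}"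
  note fC = free_map_lie_endo_carrier[OF f]
  have "ideal ?J (free_alg L)"
  proof (rule idealI[OF ring_free_alg])
    show "subgroup ?J (add_monoid (free_alg L))"
    proof
      fix q assume q: "q \<in> ?J"
      have "a_inv (free_alg L) q = - q"
        using q uideal.minus_equality[of "- q" q] by auto
      then show "inv\<^bsub>add_monoid (free_alg L)\<^esub> q \<in> ?J"
        using q by (auto simp: a_inv_def free_map_uminus uea_ideal_uminus)
    qed (auto simp: free_map_add intro: uea_ideal_add uea_ideal_zero)
  qed (use fC uideal.I_l_closed uideal.I_r_closed in \<open>auto simp: free_map_mult\<close>)
  moreover have "uea_rels L \<subseteq> ?J"
  proof
    fix r assume r: "r \<in> uea_rels L"
    from r consider
        (add) x y where "x \<in> L" "y \<in> L" "r = letter (x + y) - letter x - letter y"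
      | (smult) c x where "x \<in> L" "r = letter (c \<cdot>\<^sub>m x) - scalar c * letter x"
      | (bracket) x y where "x \<in> L" "y \<in> L"
          "r = letter x * letter y - letter y * letter x - letter (x * y - y * x)"
      unfolding uea_rels_def by blast
    then have "free_map f r \<in> uea_rels L"
    proof cases
      case add
      then have "free_map f r = letter (f x + f y) - letter (f x) - letter (f y)"
        by (simp add: free_map_diff lie_endoD[OF f])
      with add lie_endoD(1)[OF f] show ?thesis unfolding uea_rels_def by blast
    next
      case smult
      then have "free_map f r = letter (c \<cdot>\<^sub>m f x) - scalar c * letter (f x)"
        by (simp add: free_map_diff free_map_mult lie_endoD[OF f])
      with smult lie_endoD(1)[OF f] show ?thesis unfolding uea_rels_def by blast
    next
      case bracket
      then have "free_map f r = letter (f x) * letter (f y) - letter (f y) * letter (f x)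
          - letter (f x * f y - f y * f x)"
        by (simp add: free_map_diff free_map_mult lie_endoD[OF f])
      with bracket lie_endoD(1)[OF f] show ?thesis unfolding uea_rels_def by blast
    qed
    then show "r \<in> ?J"
      using r uea_rels_carrier uea_rels_ideal by blast
  qed
  ultimately have "uea_ideal L \<subseteq> ?J"
    unfolding uea_ideal_def by (rule uideal.genideal_minimal)
  with p show ?thesis by auto
qed

lemma free_map_ucong:
  assumes "lie_endo f" "x \<approx>\<^sub>U y" shows "free_map f x \<approx>\<^sub>U free_map f y"
  using assms free_map_uea_ideal[OF assms(1), of "x - y"]
  by (simp add: ucong_def free_map_lie_endo_carrier free_map_diff)

lemma uea_map_class:
  assumes f: "lie_endo f" and p: "p \<in> C"
  shows "uea_map L f (uea_class L p) = uea_class L (free_map f p)"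
proof -
  have "uea_class L (free_map f q) = uea_class L (free_map f p)" if "q \<approx>\<^sub>U p" for q
  proof -
    have "free_map f q - free_map f p \<in> uea_ideal L"
      using free_map_uea_ideal[OF f, of "q - p"] that by (simp add: ucong_def free_map_diff)
    then show ?thesis
      using that p free_map_lie_endo_carrier[OF f]
      by (subst uea_class_eq_iff) (auto simp: ucong_def)
  qed
  then show ?thesis
    unfolding uea_map_def
    by (intro the_elem_image_unique)
      (metis empty_iff mem_uea_class_iff[OF p] ucong_refl[OF p], metis mem_uea_class_iff[OF p])
qed

text \<open>Scalars are central and every element is a sum of scalar multiples of words, so commuting with
  the letters suffices.\<close>

lemma commutes_if_commutes_letters:
  assumes z: "z \<in> C" and l: "\<And>x. x \<in> L \<Longrightarrow> letter x * z \<approx>\<^sub>U z * letter x"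
    and q: "q \<in> C"
  shows "q * z \<approx>\<^sub>U z * q"
proof -
  have w: "set xs \<subseteq> L \<Longrightarrow> Poly_Mapping.single (Word xs) c * z \<approx>\<^sub>U z * Poly_Mapping.single (Word xs) c"
    for xs c
  proof (induction xs)
    case Nil
    have "Poly_Mapping.single (Word []) c = (scalar c :: complex mat free_poly)"
      by (simp add: scalar_def zero_word_def)
    then show ?case
      using z by (simp add: scalar_commute[of c z] ucong_refl free_alg_mult)
  next
    case (Cons x xs)
    let ?s = "Poly_Mapping.single (Word xs) c"
    have C: "letter x \<in> C" "?s \<in> C"
      using Cons.prems by (simp_all add: free_alg_letter carrier_free_alg[of "Poly_Mapping.single
          _ _"])
    have "Poly_Mapping.single (Word (x # xs)) c * z = letter x * (?s * z)"
      by (simp add: single_word_Cons mult.assoc)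
    also have "\<dots> \<approx>\<^sub>U letter x * (z * ?s)"
      using Cons C(1) by (intro ucong_mult[OF ucong_refl]) auto
    also have "\<dots> = (letter x * z) * ?s" by (simp add: mult.assoc)
    also have "\<dots> \<approx>\<^sub>U (z * letter x) * ?s"
      using Cons.prems C(2) by (intro ucong_mult[OF l ucong_refl]) auto
    also have "\<dots> = z * Poly_Mapping.single (Word (x # xs)) c"
      by (simp add: single_word_Cons mult.assoc)
    finally show ?case .
  qed
  show ?thesis
  proof (induction q rule: free_poly_induct)
    case (single v c)
    then show ?case using w[of "letters v" c] q by (auto simp: carrier_free_alg)
  next
    case (add a b)
    then show ?case by (simp add: ucong_add distrib_left distrib_right)
  next
    case zero
    then show ?case by (simp add: ucong_refl)
  qed
qed

end

section \<open>The complexified Lie algebra as a space of bivectors\<close>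

lemma mat_mult_entry:
  assumes "A \<in> carrier_mat k l" "B \<in> carrier_mat l n" "r < k" "c < n"
  shows "(A * B) $$ (r, c) = (\<Sum>i<l. A $$ (r, i) * B $$ (i, c))"
  using assms by (simp add: scalar_prod_def atLeast0LessThan)

text \<open>The numbers of positive and negative squares of the form.\<close>

locale signature = fixes m n :: nat
begin

abbreviation N where "N \<equiv> m + n"

abbreviation L where "L \<equiv> so_complex m n"

text \<open>The diagonal of the form, with indices starting at 0 as for matrix entries.\<close>

definition eta :: "nat \<Rightarrow> complex" where
  "eta i = (if i < m then 1 else - 1)"

lemma eta_sq [simp]: "eta i * eta i = 1" "eta i * (eta i * x) = x"
  by (simp_all add: eta_def)

lemma so_algebra_iff:
  "X \<in> so_algebra m n \<longleftrightarrow> X \<in> carrier_mat N N \<and>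
    (\<forall>r<N. \<forall>c<N. eta r * complex_of_real (X $$ (r, c)) + eta c * complex_of_real (X $$ (c, r)) = 0)"
proof -
  have "transpose_mat X * I_form m n + I_form m n * X = 0\<^sub>m N N \<longleftrightarrow>
      (\<forall>r<N. \<forall>c<N. eta r * complex_of_real (X $$ (r, c)) + eta c * complex_of_real (X $$ (c, r)) = 0)"
    if X: "X \<in> carrier_mat N N"
  proof -
    have e1: "transpose_mat X * I_form m n = mat N N (\<lambda>(r, c). X $$ (c, r) * (if c < m then 1 else
        - 1))"
      using X unfolding I_form_def
      by (subst mat_diag_mult_right[of _ N N]) (auto intro!: eq_matI)
    have e2: "I_form m n * X = mat N N (\<lambda>(r, c). (if r < m then 1 else - 1) * X $$ (r, c))"
      using X unfolding I_form_def
      by (subst mat_diag_mult_left[of _ N N]) (auto intro!: eq_matI)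
    have "transpose_mat X * I_form m n + I_form m n * X = 0\<^sub>m N N \<longleftrightarrow> (\<forall>r<N. \<forall>c<N.
        X $$ (c, r) * (if c < m then 1 else - 1) + (if r < m then 1 else - 1) * X $$ (r, c) = 0)"
      unfolding e1 e2 mat_eq_iff by simp
    moreover have "X $$ (c, r) * (if c < m then 1 else - 1) + (if r < m then 1 else - 1)
        * X $$ (r, c) = 0
        \<longleftrightarrow> eta r * complex_of_real (X $$ (r, c)) + eta c * complex_of_real (X $$ (c, r)) = 0" for r c
    proof -
      have "eta r * complex_of_real (X $$ (r, c)) + eta c * complex_of_real (X $$ (c, r)) =
        complex_of_real (X $$ (c, r) * (if c < m then 1 else - 1) + (if r < m then 1 else - 1)
            * X $$ (r, c))"
        by (simp add: eta_def)
      then show ?thesis by (simp only: of_real_eq_0_iff)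
    qed
    ultimately show ?thesis by simp
  qed
  then show ?thesis unfolding so_algebra_def by blast
qed

text \<open>The real and imaginary parts of a complex matrix satisfy the defining equations separately,
  because these have real coefficients.\<close>

lemma so_complex_iff:
  "Z \<in> L \<longleftrightarrow> Z \<in> carrier_mat N N \<and> (\<forall>r<N. \<forall>c<N. eta r * Z $$ (r, c) + eta c * Z $$ (c, r) = 0)"
  (is "?l \<longleftrightarrow> ?r")
proof
  assume ?l
  then obtain A B where Z: "Z = cmat A + \<i> \<cdot>\<^sub>m cmat B" and A: "A \<in> so_algebra m n"
    and B: "B \<in> so_algebra m n"
    unfolding so_complex_def by blast
  have car: "A \<in> carrier_mat N N" "B \<in> carrier_mat N N"
    using A B by (simp_all add: so_algebra_iff)
  have "eta r * Z $$ (r, c) + eta c * Z $$ (c, r) = 0" if rc: "r < N" "c < N" for r c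
  proof -
    have "eta r * Z $$ (r, c) + eta c * Z $$ (c, r)
        = (eta r * complex_of_real (A $$ (r, c)) + eta c * complex_of_real (A $$ (c, r)))
          + \<i> * (eta r * complex_of_real (B $$ (r, c)) + eta c * complex_of_real (B $$ (c, r)))"
      using car rc by (simp add: Z algebra_simps)
    also have "\<dots> = 0" using A B rc unfolding so_algebra_iff by simp
    finally show ?thesis .
  qed
  then show ?r using car by (simp add: Z)
next
  assume Z: ?r
  let ?A = "map_mat Re Z" and ?B = "map_mat Im Z"
  have car: "Z \<in> carrier_mat N N" using Z by blast
  have "eta r * complex_of_real (?A $$ (r, c)) + eta c * complex_of_real (?A $$ (c, r)) = 0"
    and "eta r * complex_of_real (?B $$ (r, c)) + eta c * complex_of_real (?B $$ (c, r)) = 0"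
    if "r < N" "c < N" for r c
  proof -
    have e: "eta r * Z $$ (r, c) + eta c * Z $$ (c, r) = 0"
      using Z that by blast
    have "Re (eta r * Z $$ (r, c) + eta c * Z $$ (c, r)) = 0"
      "Im (eta r * Z $$ (r, c) + eta c * Z $$ (c, r)) = 0"
      unfolding e by simp_all
    then show "eta r * complex_of_real (?A $$ (r, c)) + eta c * complex_of_real (?A $$ (c, r)) = 0"
      "eta r * complex_of_real (?B $$ (r, c)) + eta c * complex_of_real (?B $$ (c, r)) = 0"
      using car that by (simp_all add: eta_def complex_eq_iff split: if_splits)
  qed
  then have "?A \<in> so_algebra m n" "?B \<in> so_algebra m n"
    unfolding so_algebra_iff using car by simp_all
  moreover have "Z = cmat ?A + \<i> \<cdot>\<^sub>m cmat ?B"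
    using car by (intro eq_matI) (simp_all add: complex_eq_iff)
  ultimately show ?l unfolding so_complex_def by blast
qed

lemma so_complex_entry:
  assumes "Z \<in> L" "r < N" "c < N" shows "eta r * Z $$ (r, c) = - (eta c * Z $$ (c, r))"
  using assms unfolding so_complex_iff by (simp add: eq_neg_iff_add_eq_0)

lemma so_complex_carrier: "Z \<in> L \<Longrightarrow> Z \<in> carrier_mat N N"
  by (simp add: so_complex_iff)

sublocale matrix_lie_algebra L N
proof
  show "L \<subseteq> carrier_mat N N" using so_complex_carrier by blast
  fix x y assume x: "x \<in> L" and y: "y \<in> L"
  note car = so_complex_carrier[OF x] so_complex_carrier[OF y]
  have "eta r * (x + y) $$ (r, c) + eta c * (x + y) $$ (c, r) = 0" if "r < N" "c < N" for r c
    using car that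
    by (simp add: distrib_left so_complex_entry[OF x that] so_complex_entry[OF y that])
  then show "x + y \<in> L" using car by (simp add: so_complex_iff)
  have swap: "eta r * (\<Sum>k<N. a $$ (r, k) * b $$ (k, c)) = eta c * (\<Sum>k<N. b $$ (c, k) * a $$ (k, r))"
    if "a \<in> L" "b \<in> L" "r < N" "c < N" for a b r c
  proof -
    have "eta r * (a $$ (r, k) * b $$ (k, c)) = eta c * (b $$ (c, k) * a $$ (k, r))" if k:
        "k < N" for k
    proof -
      have "eta r * (a $$ (r, k) * b $$ (k, c)) = - (eta k * a $$ (k, r)) * b $$ (k, c)"
        unfolding mult.assoc[symmetric] so_complex_entry[OF \<open>a \<in> L\<close> \<open>r < N\<close> k] ..
      also have "\<dots> = - (eta k * b $$ (k, c)) * a $$ (k, r)" by simp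
      also have "\<dots> = eta c * (b $$ (c, k) * a $$ (k, r))"
        using so_complex_entry[OF \<open>b \<in> L\<close> k \<open>c < N\<close>] by simp
      finally show ?thesis .
    qed
    then show ?thesis by (simp add: sum_distrib_left)
  qed
  have "eta r * (x * y - y * x) $$ (r, c) + eta c * (x * y - y * x) $$ (c, r) = 0"
    if "r < N" "c < N" for r c
  proof -
    have e: "(x * y - y * x) $$ (i, j)
        = (\<Sum>k<N. x $$ (i, k) * y $$ (k, j)) - (\<Sum>k<N. y $$ (i, k) * x $$ (k, j))"
      if "i < N" "j < N" for i j
      using car that by (simp add: mat_mult_entry[of _ N N _ N, symmetric] del: index_mult_mat(1))
    show ?thesis
      unfolding e[OF that] e[OF that(2,1)] right_diff_distrib
      using swap[OF x y that] swap[OF y x that] by simp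
  qed
  moreover have "x * y - y * x \<in> carrier_mat N N"
    using car by (intro minus_carrier_mat mult_carrier_mat[of _ N N]) auto
  ultimately show "x * y - y * x \<in> L" unfolding so_complex_iff by blast
next
  fix x c assume x: "x \<in> L"
  have "eta r * (c \<cdot>\<^sub>m x) $$ (r, k) + eta k * (c \<cdot>\<^sub>m x) $$ (k, r) = 0" if "r < N" "k < N" for r k
    using so_complex_entry[OF x that] so_complex_carrier[OF x] that
    by (simp add: mult.left_commute[of _ c])
  then show "c \<cdot>\<^sub>m x \<in> L"
    using so_complex_carrier[OF x] by (simp add: so_complex_iff)
qed

text \<open>\<open>omega u v\<close> is the bivector \<open>u \<and> v\<close> as the endomorphism \<open>x \<mapsto> \<langle>u, x\<rangle> v - \<langle>v, x\<rangle> u\<close>.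
  Vectors are functions on row indices, of which only the values below \<open>N\<close> matter. As the group and
  the Lie algebra act factor by factor, matrix computations reduce to the action on vectors.\<close>

definition omega :: "(nat \<Rightarrow> complex) \<Rightarrow> (nat \<Rightarrow> complex) \<Rightarrow> complex mat" where
  "omega u v = mat N N (\<lambda>(r, c). (v r * u c - u r * v c) * eta c)"

definition app :: "complex mat \<Rightarrow> (nat \<Rightarrow> complex) \<Rightarrow> nat \<Rightarrow> complex" where
  "app A u = (\<lambda>r. if r < N then \<Sum>k<N. A $$ (r, k) * u k else 0)"

lemma omega_carrier [simp]: "omega u v \<in> carrier_mat N N"
  by (simp add: omega_def)

lemma omega_in_L [simp]: "omega u v \<in> L"
  by (auto simp: so_complex_iff omega_def algebra_simps)

text \<open>The Leibniz rule: in \<open>omega u v * X\<close> the skew-adjointness of \<open>X\<close> moves it onto the vectors.\<close>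

lemma omega_bracket:
  assumes X: "X \<in> L"
  shows "X * omega u v - omega u v * X = omega (app X u) v + omega u (app X v)"
proof (rule eq_matI)
  have car: "X \<in> carrier_mat N N" using X by (rule so_complex_carrier)
  fix r c assume "r < dim_row (omega (app X u) v + omega u (app X v))"
    "c < dim_col (omega (app X u) v + omega u (app X v))"
  then have rc: "r < N" "c < N" by (simp_all add: omega_def)
  have "(X * omega u v) $$ (r, c) = (\<Sum>k<N. X $$ (r, k) * ((v k * u c - u k * v c) * eta c))"
    using car rc by (simp add: mat_mult_entry[of _ N N _ N] omega_def del: index_mult_mat(1))
  also have "\<dots> = app X v r * u c * eta c - app X u r * v c * eta c"
    using rc by (simp add: app_def algebra_simps sum_subtractf sum_distrib_left)
  finally have 1: "(X * omega u v) $$ (r, c) = app X v r * u c * eta c - app X u r * v c * eta c" .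
  have "(omega u v * X) $$ (r, c) = (\<Sum>k<N. (v r * u k - u r * v k) * (eta k * X $$ (k, c)))"
    using car rc by (simp add: mat_mult_entry[of _ N N _ N] omega_def mult.assoc del:
        index_mult_mat(1))
  also have "\<dots> = (\<Sum>k<N. (v r * u k - u r * v k) * - (eta c * X $$ (c, k)))"
    using so_complex_entry[OF X _ rc(2)] by (intro sum.cong) auto
  also have "\<dots> = u r * app X v c * eta c - v r * app X u c * eta c"
    using rc by (simp add: app_def algebra_simps sum_subtractf sum_distrib_left)
  finally have 2: "(omega u v * X) $$ (r, c) = u r * app X v c * eta c - v r * app X u c * eta c" .
  have "(X * omega u v - omega u v * X) $$ (r, c) = (X * omega u v) $$ (r, c) - (omega u v
      * X) $$ (r, c)"
    using car rc by (simp add: omega_def)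
  then show "(X * omega u v - omega u v * X) $$ (r, c) = (omega (app X u) v + omega u (app X v))
      $$ (r, c)"
    unfolding 1 2 using rc by (simp add: omega_def algebra_simps)
qed (use so_complex_carrier[OF X] in \<open>auto simp: omega_def\<close>)

lemma omega_add_left: "omega (\<lambda>r. u r + u' r) v = omega u v + omega u' v"
  and omega_smult_left: "omega (\<lambda>r. a * u r) v = a \<cdot>\<^sub>m omega u v"
  and omega_swap: "omega v u = (- 1) \<cdot>\<^sub>m omega u v"
  and omega_zero_left: "omega (\<lambda>r. 0) v = 0\<^sub>m N N"
  by (auto intro!: eq_matI simp: omega_def algebra_simps)

subsection \<open>The adjoint action of the orthogonal group\<close>

text \<open>The full orthogonal group, which also contains the coordinate reflections.\<close>

definition O_group :: "real mat set" where
  "O_group = {g \<in> carrier_mat N N. transpose_mat g * I_form m n * g = I_form m n}"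

lemma I_form_sq: "I_form m n * I_form m n = 1\<^sub>m N"
  unfolding I_form_def
  by (subst mat_diag_mult_left[of _ N N]) (auto intro!: eq_matI simp: mat_diag_def)

lemma I_form_carrier [simp]: "I_form m n \<in> carrier_mat N N"
  by (simp add: I_form_def)

text \<open>The equation \<open>g\<^sup>t I g = I\<close> exhibits \<open>I g\<^sup>t I\<close> as the inverse, so that conjugation by \<open>g\<close> is
  given by polynomials in the entries of \<open>g\<close>.\<close>

lemma O_group_inverse:
  assumes g: "g \<in> O_group"
  defines "h \<equiv> I_form m n * transpose_mat g * I_form m n"
  shows "h \<in> carrier_mat N N" "g * h = 1\<^sub>m N" "h * g = 1\<^sub>m N" "the (mat_inverse g) = h"
proof -
  have car: "g \<in> carrier_mat N N" using g by (simp add: O_group_def)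
  show h: "h \<in> carrier_mat N N"
    unfolding h_def by (intro mult_carrier_mat[of _ N N] I_form_carrier) (use car in simp)
  have "h * g = I_form m n * (transpose_mat g * I_form m n * g)"
    using car by (simp add: h_def assoc_mult_mat[of _ N N _ N _ N])
  then show hg: "h * g = 1\<^sub>m N"
    using g by (simp add: O_group_def I_form_sq)
  then show gh: "g * h = 1\<^sub>m N"
    using mat_mult_left_right_inverse[OF h car] by simp
  have "g \<in> Units (ring_mat TYPE(real) N ())"
    using h car hg gh by (auto simp: Units_def ring_mat_def)
  then obtain k where k: "mat_inverse g = Some k"
    using mat_inverse(1)[OF car, where b = "()"] by (cases "mat_inverse g") auto
  then have "g * k = 1\<^sub>m N" "k \<in> carrier_mat N N"
    using mat_inverse(2)[OF car] by auto
  then have "k = h * (g * k)"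
    using car h hg assoc_mult_mat[OF h car, of k N] by simp
  then show "the (mat_inverse g) = h"
    using k h \<open>g * k = 1\<^sub>m N\<close> by simp
qed

lemma Ad_entry:
  assumes g: "g \<in> O_group" and X: "X \<in> carrier_mat N N" and rc: "r < N" "c < N"
  shows "Ad g X $$ (r, c) =
    (\<Sum>l<N. \<Sum>k<N. complex_of_real (g $$ (r, k)) * X $$ (k, l) * (eta l * complex_of_real (g $$ (c,
        l)) * eta c))"
proof -
  have car: "g \<in> carrier_mat N N" using g by (simp add: O_group_def)
  have inv: "complex_of_real (the (mat_inverse g) $$ (l, c)) = eta l * complex_of_real (g $$ (c,
      l)) * eta c"
    if "l < N" for l
    unfolding O_group_inverse(4)[OF g] I_form_def using car rc that
    by (subst mat_diag_mult_left[of _ N N], simp, subst mat_diag_mult_right[of _ N N])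
      (auto simp: eta_def)
  have "the (mat_inverse g) \<in> carrier_mat N N"
    using O_group_inverse(1,4)[OF g] by simp
  then have "Ad g X $$ (r, c) =
      (\<Sum>l<N. (cmat g * X) $$ (r, l) * complex_of_real (the (mat_inverse g) $$ (l, c)))"
    unfolding Ad_def using car X rc
    by (subst mat_mult_entry[of _ N N _ N]) (auto intro!: mult_carrier_mat[of _ N N])
  also have "\<dots> = (\<Sum>l<N. (\<Sum>k<N. complex_of_real (g $$ (r, k)) * X $$ (k, l))
      * (eta l * complex_of_real (g $$ (c, l)) * eta c))"
    using car X rc
    by (intro sum.cong refl) (simp add: inv mat_mult_entry[of _ N N _ N] del: index_mult_mat(1))
  finally show ?thesis by (simp only: sum_distrib_right)
qed

lemma Ad_carrier:
  assumes "g \<in> O_group" "X \<in> carrier_mat N N" shows "Ad g X \<in> carrier_mat N N"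
  using assms O_group_inverse(1,4)[OF assms(1)] unfolding Ad_def
  by (intro mult_carrier_mat[of _ N N]) (auto simp: O_group_def)

lemma Ad_in_L:
  assumes g: "g \<in> O_group" and X: "X \<in> L" shows "Ad g X \<in> L"
proof -
  note car = so_complex_carrier[OF X]
  have "eta r * Ad g X $$ (r, c) = - (eta c * Ad g X $$ (c, r))" if rc: "r < N" "c < N" for r c
  proof -
    have "eta r * Ad g X $$ (r, c) = (\<Sum>l<N. \<Sum>k<N. eta r * eta c * complex_of_real (g $$ (r, k))
        * complex_of_real (g $$ (c, l)) * (eta l * X $$ (k, l)))"
      by (simp add: Ad_entry[OF g car rc] sum_distrib_left algebra_simps)
    also have "\<dots> = (\<Sum>k<N. \<Sum>l<N. eta r * eta c * complex_of_real (g $$ (r, k))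
        * complex_of_real (g $$ (c, l)) * (eta l * X $$ (k, l)))"
      by (rule sum.swap)
    also have "\<dots> = (\<Sum>k<N. \<Sum>l<N. - (eta r * eta c * complex_of_real (g $$ (r, k))
        * complex_of_real (g $$ (c, l)) * (eta k * X $$ (l, k))))"
    proof (intro sum.cong refl)
      fix k l assume kl: "k \<in> {..<N}" "l \<in> {..<N}"
      have "eta l * X $$ (k, l) = eta l * (eta k * (eta k * X $$ (k, l)))" by simp
      also have "\<dots> = - (eta k * X $$ (l, k))"
        using so_complex_entry[OF X, of k l] kl by (simp add: mult.left_commute[of "eta l"])
      finally show "eta r * eta c * complex_of_real (g $$ (r, k)) * complex_of_real (g $$ (c, l))
          * (eta l * X $$ (k, l)) = - (eta r * eta c * complex_of_real (g $$ (r, k))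
          * complex_of_real (g $$ (c, l)) * (eta k * X $$ (l, k)))"
        by simp
    qed
    also have "\<dots> = - (eta c * Ad g X $$ (c, r))"
      by (simp add: Ad_entry[OF g car rc(2,1)] sum_distrib_left sum_negf algebra_simps)
    finally show ?thesis .
  qed
  then show ?thesis
    using Ad_carrier[OF g car] unfolding so_complex_iff by (simp add: eq_neg_iff_add_eq_0)
qed

lemma lie_endo_Ad:
  assumes g: "g \<in> O_group" shows "lie_endo (Ad g)"
proof -
  let ?g = "cmat g" and ?h = "cmat (the (mat_inverse g))"
  have car: "?g \<in> carrier_mat N N" "?h \<in> carrier_mat N N"
    using g O_group_inverse(1,4)[OF g] by (auto simp: O_group_def)
  have "?h * ?g = cmat (the (mat_inverse g) * g)"
    using g O_group_inverse(1,4)[OF g]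
    by (subst of_real_hom.mat_hom_mult[of _ N N _ N]) (auto simp: O_group_def)
  then have hg: "?h * ?g = 1\<^sub>m N"
    using O_group_inverse(3,4)[OF g] by (simp add: of_real_hom.mat_hom_one)
  have mult: "Ad g (x * y) = Ad g x * Ad g y" if "x \<in> L" "y \<in> L" for x y
  proof -
    note c = so_complex_carrier[OF that(1)] so_complex_carrier[OF that(2)]
    have "Ad g x * Ad g y = ?g * x * (?h * ?g) * y * ?h"
      using car c unfolding Ad_def by (simp add: assoc_mult_mat[of _ N N _ N _ N])
    then show ?thesis
      using car c unfolding hg Ad_def by (simp add: assoc_mult_mat[of _ N N _ N _ N])
  qed
  have diff: "Ad g (x - y) = Ad g x - Ad g y"
    if "x \<in> carrier_mat N N" "y \<in> carrier_mat N N" for x y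
    using car that unfolding Ad_def
    by (simp add: mult_minus_distrib_mat[of _ N N _ N] minus_mult_distrib_mat[of _ N N _ _ N])
  show ?thesis
    unfolding lie_endo_def
  proof (intro conjI ballI allI)
    show "Ad g ` L \<subseteq> L" using Ad_in_L[OF g] by blast
  next
    fix x y assume xy: "x \<in> L" "y \<in> L"
    note c = so_complex_carrier[OF xy(1)] so_complex_carrier[OF xy(2)]
    show "Ad g (x + y) = Ad g x + Ad g y"
      using car c unfolding Ad_def
      by (simp add: mult_add_distrib_mat[of _ N N _ N] add_mult_distrib_mat[of _ N N _ _ N])
    show "Ad g (x * y - y * x) = Ad g x * Ad g y - Ad g y * Ad g x"
      using c by (simp add: diff mult xy)
  next
    fix c x assume "x \<in> L"
    then show "Ad g (c \<cdot>\<^sub>m x) = c \<cdot>\<^sub>m Ad g x"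
      using car so_complex_carrier[of x] unfolding Ad_def
      by (simp add: mult_smult_distrib[of _ N N _ N] mult_smult_assoc_mat[of _ N N _ N])
  qed
qed

lemma app_mult_app:
  assumes "r < N" "c < N"
  shows "app A v r * app A u c = (\<Sum>l<N. \<Sum>k<N. (A $$ (r, k) * v k) * (A $$ (c, l) * u l))"
proof -
  have "app A v r * app A u c = (\<Sum>k<N. \<Sum>l<N. (A $$ (r, k) * v k) * (A $$ (c, l) * u l))"
    using assms by (simp only: app_def if_True sum_product)
  also have "\<dots> = (\<Sum>l<N. \<Sum>k<N. (A $$ (r, k) * v k) * (A $$ (c, l) * u l))"
    by (rule sum.swap)
  finally show ?thesis .
qed

lemma Ad_omega:
  assumes g: "g \<in> O_group"
  shows "Ad g (omega u v) = omega (app (cmat g) u) (app (cmat g) v)"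
proof (rule eq_matI)
  have car: "g \<in> carrier_mat N N" using g by (simp add: O_group_def)
  fix r c assume "r < dim_row (omega (app (cmat g) u) (app (cmat g) v))"
    "c < dim_col (omega (app (cmat g) u) (app (cmat g) v))"
  then have rc: "r < N" "c < N" by (simp_all add: omega_def)
  have "Ad g (omega u v) $$ (r, c) = (\<Sum>l<N. \<Sum>k<N. (cmat g $$ (r, k) * v k) *
      (cmat g $$ (c, l) * u l) * eta c) - (\<Sum>l<N. \<Sum>k<N. (cmat g $$ (r, k) * u k) *
      (cmat g $$ (c, l) * v l) * eta c)"
    unfolding Ad_entry[OF g omega_carrier rc] sum_subtractf[symmetric]
  proof (intro sum.cong refl)
    fix l k assume "l \<in> {..<N}" "k \<in> {..<N}"
    then show "complex_of_real (g $$ (r, k)) * omega u v $$ (k, l) * (eta l * complex_of_real (g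
        $$ (c, l)) * eta c)
      = (cmat g $$ (r, k) * v k) * (cmat g $$ (c, l) * u l) * eta c
      - (cmat g $$ (r, k) * u k) * (cmat g $$ (c, l) * v l) * eta c"
      using car rc by (simp add: omega_def algebra_simps)
  qed
  also have "\<dots> = (app (cmat g) v r * app (cmat g) u c - app (cmat g) u r * app (cmat g) v c) * eta c"
    by (simp add: app_mult_app[OF rc] sum_distrib_right left_diff_distrib)
  finally show "Ad g (omega u v) $$ (r, c) = omega (app (cmat g) u) (app (cmat g) v) $$ (r, c)"
    using rc by (simp add: omega_def)
qed (use Ad_carrier[OF g omega_carrier] in \<open>auto simp: omega_def\<close>)

lemma SO_0_subset_O_group: "SO_0 m n \<subseteq> O_group"
  using connected_component_of_subset_topspace[of "subtopology (mat_topology N) (SO_group m n)"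
      "1\<^sub>m N"]
  unfolding SO_0_def O_group_def SO_group_def by auto

end

section \<open>Noncommutative Pfaffians of tuples of vectors\<close>

context signature
begin

notation ucong (infix "\<approx>\<^sub>U" 50)

text \<open>The bivector as an element of the free algebra representing its image in the enveloping
  algebra.\<close>

definition wedge :: "(nat \<Rightarrow> complex) \<Rightarrow> (nat \<Rightarrow> complex) \<Rightarrow> complex mat free_poly" where
  "wedge u v = letter (omega u v)"

lemma wedge_carrier [simp, intro]: "wedge u v \<in> C"
  by (simp add: wedge_def free_alg_letter)

lemma wedge_swap: "wedge v u \<approx>\<^sub>U - wedge u v"
  using letter_smult[OF omega_in_L, of "-1" u v]
  by (simp add: wedge_def omega_swap[of v u] scalar_uminus)

lemma wedge_sum_left:
  assumes "finite A"
  shows "wedge (\<lambda>r. \<Sum>k\<in>A. a k * w k r) v \<approx>\<^sub>U (\<Sum>k\<in>A. scalar (a k) * wedge (w k) v)"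
  using assms
proof (induction A rule: finite_induct)
  case empty
  then show ?case
    using letter_zero[OF omega_in_L] by (simp add: wedge_def omega_zero_left)
next
  case (insert x A)
  have "wedge (\<lambda>r. \<Sum>k\<in>insert x A. a k * w k r) v
      = letter (a x \<cdot>\<^sub>m omega (w x) v + omega (\<lambda>r. \<Sum>k\<in>A. a k * w k r) v)"
    using insert.hyps by (simp add: wedge_def omega_add_left omega_smult_left)
  also have "\<dots> \<approx>\<^sub>U letter (a x \<cdot>\<^sub>m omega (w x) v) + wedge (\<lambda>r. \<Sum>k\<in>A. a k * w k r) v"
    unfolding wedge_def by (intro letter_add L_smult omega_in_L)
  also have "\<dots> \<approx>\<^sub>U scalar (a x) * wedge (w x) v + (\<Sum>k\<in>A. scalar (a k) * wedge (w k) v)"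
    using insert.IH unfolding wedge_def by (intro ucong_add letter_smult omega_in_L)
  finally show ?case using insert.hyps by simp
qed

lemma wedge_sum_right:
  assumes "finite A"
  shows "wedge v (\<lambda>r. \<Sum>k\<in>A. a k * w k r) \<approx>\<^sub>U (\<Sum>k\<in>A. scalar (a k) * wedge v (w k))"
proof -
  have "wedge v (\<lambda>r. \<Sum>k\<in>A. a k * w k r) \<approx>\<^sub>U - wedge (\<lambda>r. \<Sum>k\<in>A. a k * w k r) v"
    by (rule wedge_swap)
  also have "\<dots> \<approx>\<^sub>U - (\<Sum>k\<in>A. scalar (a k) * wedge (w k) v)"
    by (intro ucong_uminus wedge_sum_left assms)
  also have "\<dots> = (\<Sum>k\<in>A. scalar (a k) * - wedge (w k) v)"
    by (simp add: sum_negf)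
  also have "\<dots> \<approx>\<^sub>U (\<Sum>k\<in>A. scalar (a k) * wedge v (w k))"
    by (intro ucong_sum ucong_scalar ucong_sym[OF wedge_swap])
  finally show ?thesis .
qed

lemma wedge_bracket:
  assumes "X \<in> L"
  shows "letter X * wedge u v - wedge u v * letter X \<approx>\<^sub>U wedge (app X u) v + wedge u (app X v)"
proof -
  have "letter X * wedge u v - wedge u v * letter X \<approx>\<^sub>U letter (omega (app X u) v
      + omega u (app X v))"
    using letter_bracket[OF assms omega_in_L, of u v] by (simp add: wedge_def omega_bracket[OF assms])
  also have "\<dots> \<approx>\<^sub>U wedge (app X u) v + wedge u (app X v)"
    unfolding wedge_def by (intro letter_add omega_in_L)
  finally show ?thesis .
qed

primrec pair_prod :: "nat \<Rightarrow> (nat \<Rightarrow> nat \<Rightarrow> complex) \<Rightarrow> complex mat free_poly" where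
  "pair_prod 0 v = 1"
| "pair_prod (Suc p) v = pair_prod p v * wedge (v (2 * p)) (v (2 * p + 1))"

lemma pair_prod_carrier [simp, intro]: "pair_prod p v \<in> C"
  by (induction p) (auto intro: free_alg_mult)

lemma pair_prod_cong: "(\<And>j. j < 2 * p \<Longrightarrow> v j = w j) \<Longrightarrow> pair_prod p v = pair_prod p w"
  by (induction p) auto

text \<open>A slot occurs in exactly one factor, and each factor is bilinear.\<close>

lemma pair_prod_slot_sum:
  assumes "finite A" "b < 2 * p"
  shows "pair_prod p (v(b := \<lambda>r. \<Sum>k\<in>A. a k * w k r))
    \<approx>\<^sub>U (\<Sum>k\<in>A. scalar (a k) * pair_prod p (v(b := w k)))"
  using assms(2)
proof (induction p)
  case 0
  then show ?case by simp
next
  case (Suc p)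
  let ?s = "\<lambda>r. \<Sum>k\<in>A. a k * w k r"
  consider "b < 2 * p" | "b = 2 * p" | "b = 2 * p + 1" using Suc.prems by (atomize_elim) presburger
  then show ?case
  proof cases
    case 1
    then have "pair_prod (Suc p) (v(b := ?s)) = pair_prod p (v(b := ?s)) * wedge (v (2 * p)) (v (2
        * p + 1))"
      by simp
    also have "\<dots> \<approx>\<^sub>U (\<Sum>k\<in>A. scalar (a k) * pair_prod p (v(b := w k))) * wedge (v (2 * p)) (v (2
        * p + 1))"
      using Suc.IH[OF 1] by (intro ucong_mult ucong_refl wedge_carrier)
    also have "\<dots> = (\<Sum>k\<in>A. scalar (a k) * pair_prod (Suc p) (v(b := w k)))"
      using 1 by (simp add: sum_distrib_right mult.assoc)
    finally show ?thesis .
  next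
    case 2
    have p: "pair_prod p (v(b := x)) = pair_prod p v" for x by (rule pair_prod_cong) (use 2 in auto)
    have "pair_prod (Suc p) (v(b := ?s)) = pair_prod p v * wedge ?s (v (2 * p + 1))"
      using 2 p by simp
    also have "\<dots> \<approx>\<^sub>U pair_prod p v * (\<Sum>k\<in>A. scalar (a k) * wedge (w k) (v (2 * p + 1)))"
      by (intro ucong_mult[OF ucong_refl] wedge_sum_left assms pair_prod_carrier)
    also have "\<dots> = (\<Sum>k\<in>A. scalar (a k) * pair_prod (Suc p) (v(b := w k)))"
      using 2 p by (simp add: sum_distrib_left mult_scalar_left)
    finally show ?thesis .
  next
    case 3
    have p: "pair_prod p (v(b := x)) = pair_prod p v" for x by (rule pair_prod_cong) (use 3 in auto)
    have "pair_prod (Suc p) (v(b := ?s)) = pair_prod p v * wedge (v (2 * p)) ?s"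
      using 3 p by simp
    also have "\<dots> \<approx>\<^sub>U pair_prod p v * (\<Sum>k\<in>A. scalar (a k) * wedge (v (2 * p)) (w k))"
      by (intro ucong_mult[OF ucong_refl] wedge_sum_right assms pair_prod_carrier)
    also have "\<dots> = (\<Sum>k\<in>A. scalar (a k) * pair_prod (Suc p) (v(b := w k)))"
      using 3 p by (simp add: sum_distrib_left mult_scalar_left)
    finally show ?thesis .
  qed
qed

text \<open>Commutation with \<open>X\<close> is a derivation of the product, and the two slots of each factor obey
  the Leibniz rule.\<close>

lemma pair_prod_bracket:
  assumes X: "X \<in> L"
  shows "letter X * pair_prod p v - pair_prod p v * letter X \<approx>\<^sub>U (\<Sum>b<2 * p. pair_prod p (v(b :=
      app X (v b))))"
proof (induction p)
  case 0
  then show ?case by (simp add: ucong_refl)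
next
  case (Suc p)
  let ?F = "wedge (v (2 * p)) (v (2 * p + 1))"
  have c: "pair_prod p (v(2 * p := x)) = pair_prod p v" "pair_prod p (v(2 * p + 1 := x))
      = pair_prod p v" for x
    by (auto intro: pair_prod_cong)
  have "letter X * pair_prod (Suc p) v - pair_prod (Suc p) v * letter X
      = (letter X * pair_prod p v - pair_prod p v * letter X) * ?F + pair_prod p v * (letter X
          * ?F - ?F * letter X)"
    by (simp add: algebra_simps)
  also have "\<dots> \<approx>\<^sub>U (\<Sum>b<2 * p. pair_prod p (v(b := app X (v b)))) * ?F
      + pair_prod p v * (wedge (app X (v (2 * p))) (v (2 * p + 1)) + wedge (v (2
          * p)) (app X (v (2 * p + 1))))"
    by (intro ucong_add ucong_mult[OF Suc.IH ucong_refl] ucong_mult[OF ucong_refl wedge_bracket]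
        X wedge_carrier pair_prod_carrier)
  also have "\<dots> = (\<Sum>b<2 * p. pair_prod (Suc p) (v(b := app X (v b))))
      + pair_prod (Suc p) (v(2 * p := app X (v (2 * p)))) + pair_prod (Suc p) (v(2 * p
          + 1 := app X (v (2 * p + 1))))"
  proof -
    have "(\<Sum>b<2 * p. pair_prod p (v(b := app X (v b)))) * ?F = (\<Sum>b<2 * p. pair_prod (Suc p) (v(b
        := app X (v b))))"
      unfolding sum_distrib_right by (intro sum.cong refl) simp
    moreover have "pair_prod (Suc p) (v(2 * p := app X (v (2 * p)))) = pair_prod p v
        * wedge (app X (v (2 * p))) (v (2 * p + 1))"
      using c(1) by simp
    moreover have "pair_prod (Suc p) (v(2 * p + 1 := app X (v (2 * p + 1)))) = pair_prod p v
        * wedge (v (2 * p)) (app X (v (2 * p + 1)))"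
      using c(2) by simp
    ultimately show ?thesis by (simp only: distrib_left add.assoc)
  qed
  also have "\<dots> = (\<Sum>b<2 * Suc p. pair_prod (Suc p) (v(b := app X (v b))))"
    by (simp del: pair_prod.simps)
  finally show ?case .
qed

lemma free_map_pair_prod:
  "g \<in> O_group \<Longrightarrow> free_map (Ad g) (pair_prod p v) = pair_prod p (\<lambda>j. app (cmat g) (v j))"
  by (induction p) (simp_all add: free_map_mult wedge_def Ad_omega)

text \<open>Up to the factor \<open>2\<^sup>p p!\<close>, this is the Pfaffian of the matrix of bivectors \<open>v\<^sub>i \<and> v\<^sub>j\<close> with
  noncommuting entries. Summation over all permutations makes it alternating by construction.\<close>

definition pfaffian :: "nat \<Rightarrow> (nat \<Rightarrow> nat \<Rightarrow> complex) \<Rightarrow> complex mat free_poly" where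
  "pfaffian p v = (\<Sum>\<tau> | \<tau> permutes {..<2 * p}. scalar (of_int (sign \<tau>)) * pair_prod p (v \<circ> \<tau>))"

lemma pfaffian_carrier [simp, intro]: "pfaffian p v \<in> C"
  unfolding pfaffian_def by (intro free_alg_sum free_alg_mult) auto

lemma free_map_pfaffian:
  "g \<in> O_group \<Longrightarrow> free_map (Ad g) (pfaffian p v) = pfaffian p (\<lambda>j. app (cmat g) (v j))"
  by (simp add: pfaffian_def free_map_sum free_map_mult free_map_pair_prod o_def)

lemma pfaffian_cong:
  assumes "\<And>j. j < 2 * p \<Longrightarrow> v j = w j" shows "pfaffian p v = pfaffian p w"
  unfolding pfaffian_def
proof (intro sum.cong refl arg_cong2[of _ _ _ _ "(*)"] pair_prod_cong)
  fix \<tau> j assume "\<tau> \<in> {\<tau>. \<tau> permutes {..<2 * p}}" "j < 2 * p"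
  then show "(v \<circ> \<tau>) j = (w \<circ> \<tau>) j"
    using permutes_in_image[of \<tau> "{..<2 * p}" j] assms by auto
qed

lemma fun_upd_comp_permutes:
  assumes "\<tau> permutes S" shows "v(b := x) \<circ> \<tau> = (v \<circ> \<tau>)(Hilbert_Choice.inv \<tau> b := x)"
  using permutes_inverses[OF assms] by (auto simp: fun_eq_iff)

text \<open>In the summand of \<open>\<tau>\<close>, slot \<open>b\<close> of the tuple has moved to slot \<open>\<tau>\<^sup>-\<^sup>1 b\<close> of the product.\<close>

lemma pfaffian_slot_sum:
  assumes "finite A" "b < 2 * p"
  shows "pfaffian p (v(b := \<lambda>r. \<Sum>k\<in>A. a k * w k r)) \<approx>\<^sub>U (\<Sum>k\<in>A. scalar (a k) * pfaffian p (v(b := w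
      k)))"
proof -
  let ?S = "{\<tau>. \<tau> permutes {..<2 * p}}"
  have "pfaffian p (v(b := \<lambda>r. \<Sum>k\<in>A. a k * w k r))
      \<approx>\<^sub>U (\<Sum>\<tau>\<in>?S. scalar (of_int (sign \<tau>)) * (\<Sum>k\<in>A. scalar (a k) * pair_prod p (v(b := w k) \<circ> \<tau>)))"
    unfolding pfaffian_def
  proof (intro ucong_sum ucong_scalar)
    fix \<tau> assume "\<tau> \<in> ?S"
    then have \<tau>: "\<tau> permutes {..<2 * p}" by simp
    have "Hilbert_Choice.inv \<tau> b < 2 * p"
      using permutes_in_image[OF permutes_inv[OF \<tau>], of b] assms(2) by simp
    then show "pair_prod p (v(b := \<lambda>r. \<Sum>k\<in>A. a k * w k r) \<circ> \<tau>)
        \<approx>\<^sub>U (\<Sum>k\<in>A. scalar (a k) * pair_prod p (v(b := w k) \<circ> \<tau>))"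
      unfolding fun_upd_comp_permutes[OF \<tau>] by (rule pair_prod_slot_sum[OF assms(1)])
  qed
  also have "\<dots> = (\<Sum>k\<in>A. scalar (a k) * pfaffian p (v(b := w k)))"
    unfolding pfaffian_def sum_distrib_left mult_scalar_left[of "scalar _"] by (rule sum.swap)
  finally show ?thesis .
qed

lemma pfaffian_bracket:
  assumes X: "X \<in> L"
  shows "letter X * pfaffian p v - pfaffian p v * letter X \<approx>\<^sub>U (\<Sum>b<2 * p. pfaffian p (v(b := app X
      (v b))))"
proof -
  let ?S = "{\<tau>. \<tau> permutes {..<2 * p}}"
  have "letter X * pfaffian p v - pfaffian p v * letter X
      = (\<Sum>\<tau>\<in>?S. scalar (of_int (sign \<tau>)) * (letter X * pair_prod p (v \<circ> \<tau>) - pair_prod p (v \<circ> \<tau>)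
          * letter X))"
    unfolding pfaffian_def
    by (simp add: sum_distrib_left sum_distrib_right sum_subtractf mult_scalar_left mult.assoc
        right_diff_distrib)
  also have "\<dots> \<approx>\<^sub>U (\<Sum>\<tau>\<in>?S. scalar (of_int (sign \<tau>)) *
      (\<Sum>b<2 * p. pair_prod p ((v \<circ> \<tau>)(b := app X ((v \<circ> \<tau>) b)))))"
    by (intro ucong_sum ucong_scalar pair_prod_bracket X)
  also have "\<dots> = (\<Sum>\<tau>\<in>?S. scalar (of_int (sign \<tau>)) *
      (\<Sum>b<2 * p. pair_prod p (v(b := app X (v b)) \<circ> \<tau>)))"
  proof (rule sum.cong[OF refl], rule arg_cong2[of _ _ _ _ "(*)", OF refl])
    fix \<tau> assume "\<tau> \<in> ?S"
    then have \<tau>: "\<tau> permutes {..<2 * p}" by simp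
    have "(\<Sum>b<2 * p. pair_prod p (v(b := app X (v b)) \<circ> \<tau>))
        = (\<Sum>b<2 * p. pair_prod p (v(\<tau> b := app X (v (\<tau> b))) \<circ> \<tau>))"
      using sum.permute[OF \<tau>, of "\<lambda>b. pair_prod p (v(b := app X (v b)) \<circ> \<tau>)"] by simp
    also have "\<dots> = (\<Sum>b<2 * p. pair_prod p ((v \<circ> \<tau>)(b := app X ((v \<circ> \<tau>) b))))"
      by (simp add: fun_upd_comp_permutes[OF \<tau>] permutes_inverses[OF \<tau>])
    finally show "(\<Sum>b<2 * p. pair_prod p ((v \<circ> \<tau>)(b := app X ((v \<circ> \<tau>) b))))
        = (\<Sum>b<2 * p. pair_prod p (v(b := app X (v b)) \<circ> \<tau>))" ..
  qed
  also have "\<dots> = (\<Sum>b<2 * p. pfaffian p (v(b := app X (v b))))"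
    unfolding pfaffian_def sum_distrib_left by (rule sum.swap)
  finally show ?thesis .
qed

lemma pfaffian_permute:
  assumes \<pi>: "\<pi> permutes {..<2 * p}"
  shows "pfaffian p (v \<circ> \<pi>) = scalar (of_int (sign \<pi>)) * pfaffian p v"
proof -
  have "pfaffian p v = (\<Sum>\<tau> | \<tau> permutes {..<2 * p}. scalar (of_int (sign (\<pi> \<circ> \<tau>)))
      * pair_prod p (v \<circ> (\<pi> \<circ> \<tau>)))"
    unfolding pfaffian_def by (rule setum_permutations_compose_left[OF \<pi>])
  also have "\<dots> = (\<Sum>\<tau> | \<tau> permutes {..<2 * p}. scalar (of_int (sign \<pi>)) *
      (scalar (of_int (sign \<tau>)) * pair_prod p (v \<circ> \<pi> \<circ> \<tau>)))"
  proof (intro sum.cong refl)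
    fix \<tau> assume "\<tau> \<in> {\<tau>. \<tau> permutes {..<2 * p}}"
    then have "sign (\<pi> \<circ> \<tau>) = sign \<pi> * sign \<tau>"
      using \<pi> permutation_permutes finite_lessThan by (intro sign_compose) blast+
    then show "scalar (of_int (sign (\<pi> \<circ> \<tau>))) * pair_prod p (v \<circ> (\<pi> \<circ> \<tau>))
        = scalar (of_int (sign \<pi>)) * (scalar (of_int (sign \<tau>)) * pair_prod p (v \<circ> \<pi> \<circ> \<tau>))"
      by (simp add: mult.assoc[symmetric] scalar_mult comp_assoc)
  qed
  finally have "pfaffian p v = scalar (of_int (sign \<pi>)) * pfaffian p (v \<circ> \<pi>)"
    by (simp add: pfaffian_def sum_distrib_left)
  moreover have "of_int (sign \<pi>) * of_int (sign \<pi>) = (1 :: complex)"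
    by (simp add: sign_def)
  ultimately show ?thesis
    by (simp add: mult.assoc[symmetric] scalar_mult)
qed

text \<open>Exchanging the two equal slots changes the sign and nothing else.\<close>

lemma pfaffian_repeated:
  assumes "a < 2 * p" "b < 2 * p" "a \<noteq> b" "v a = v b"
  shows "pfaffian p v \<approx>\<^sub>U 0"
proof (rule ucong_neg_self)
  have "v \<circ> transpose a b = v"
    using assms(4) by (auto simp: fun_eq_iff transpose_def)
  moreover have "transpose a b permutes {..<2 * p}"
    using assms by (intro permutes_swap_id) auto
  ultimately have "pfaffian p v = - pfaffian p v"
    using pfaffian_permute[of "transpose a b" p v] assms(3) by (simp add: sign_swap_id scalar_uminus)
  then show "pfaffian p v \<approx>\<^sub>U - pfaffian p v"
    using ucong_refl[OF pfaffian_carrier, of p v] by simp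
qed

subsection \<open>An orthonormal basis\<close>

text \<open>Scaling the last \<open>n\<close> basis vectors by \<open>- \<i>\<close> makes the basis orthonormal for the complexified
  form, so that the signature disappears from all formulas. Indices of basis vectors start at 1,
  like those of \<open>X_bar\<close>, whereas the arguments of vectors are row indices, starting at 0.\<close>

definition basis_scale :: "nat \<Rightarrow> complex" where
  "basis_scale i = (if i \<le> m then 1 else - \<i>)"

definition bvec :: "nat \<Rightarrow> nat \<Rightarrow> complex" where
  "bvec i = (\<lambda>r. if Suc r = i then basis_scale i else 0)"

lemma basis_scale_sq: "1 \<le> i \<Longrightarrow> basis_scale i * basis_scale i = eta (i - 1)"
  by (auto simp: basis_scale_def eta_def)

lemma X_bar_eq_omega:
  assumes "1 \<le> i" "i < j" "j \<le> N"
  shows "X_bar m n i j = omega (bvec i) (bvec j)"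
  using assms
  by (intro eq_matI)
    (auto simp: X_bar_def X_mat_def Y_mat_def mat_unit_def omega_def bvec_def basis_scale_def eta_def)

text \<open>The inverse of the scale factor \<open>s\<close> of a basis vector is \<open>s \<cdot> eta\<close>, as \<open>s\<^sup>2 = eta\<close>.\<close>

lemma bvec_expand:
  assumes "\<And>r. r \<ge> N \<Longrightarrow> u r = 0"
  shows "u = (\<lambda>r. \<Sum>k\<in>{1..N}. (u (k - 1) * basis_scale k * eta (k - 1)) * bvec k r)"
proof
  fix r
  have "(\<Sum>k\<in>{1..N}. (u (k - 1) * basis_scale k * eta (k - 1)) * bvec k r)
      = (\<Sum>k\<in>{1..N}. if k = Suc r then u r * basis_scale k * eta r * basis_scale k else 0)"
    by (intro sum.cong) (auto simp: bvec_def)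
  also have "\<dots> = (if r < N then u r * basis_scale (Suc r) * eta r * basis_scale (Suc r) else 0)"
    by (simp add: sum.delta')
  also have "\<dots> = u r"
    using assms[of r] basis_scale_sq[of "Suc r"] by (auto simp: mult_ac)
  finally show "u r = (\<Sum>k\<in>{1..N}. (u (k - 1) * basis_scale k * eta (k - 1)) * bvec k r)" ..
qed

text \<open>The matrix of \<open>X\<close> in the orthonormal basis; both indices start at 1.\<close>

definition coord :: "complex mat \<Rightarrow> nat \<Rightarrow> nat \<Rightarrow> complex" where
  "coord X k j = eta (k - 1) * X $$ (k - 1, j - 1) * (basis_scale k * basis_scale j)"

lemma app_bvec:
  assumes "j \<in> {1..N}"
  shows "app X (bvec j) = (\<lambda>r. \<Sum>k\<in>{1..N}. coord X k j * bvec k r)"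
proof -
  have e: "app X (bvec j) r = X $$ (r, j - 1) * basis_scale j" if "r < N" for r
  proof -
    have "app X (bvec j) r = (\<Sum>k<N. X $$ (r, k) * bvec j k)"
      using that by (simp add: app_def)
    also have "\<dots> = (\<Sum>k<N. if k = j - 1 then X $$ (r, j - 1) * basis_scale j else 0)"
      using assms by (intro sum.cong refl) (auto simp: bvec_def)
    also have "\<dots> = X $$ (r, j - 1) * basis_scale j" using assms by (auto simp: sum.delta')
    finally show ?thesis .
  qed
  have "app X (bvec j) (k - 1) * basis_scale k * eta (k - 1) = coord X k j" if "k \<in> {1..N}" for k
  proof -
    have "k - 1 < N" using that by auto
    from e[OF this] show ?thesis by (simp add: coord_def)
  qed
  then have "(\<Sum>k\<in>{1..N}. app X (bvec j) (k - 1) * basis_scale k * eta (k - 1) * bvec k r)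
      = (\<Sum>k\<in>{1..N}. coord X k j * bvec k r)" for r
    by (intro sum.cong) auto
  moreover have "app X (bvec j) = (\<lambda>r. \<Sum>k\<in>{1..N}. app X (bvec j) (k - 1) * basis_scale k * eta (k
      - 1) * bvec k r)"
    by (rule bvec_expand) (simp add: app_def)
  ultimately show ?thesis by simp
qed

text \<open>An element of the Lie algebra is skew-symmetric in an orthonormal basis.\<close>

lemma coord_antisym:
  assumes "X \<in> L" "j \<in> {1..N}" "k \<in> {1..N}" shows "coord X j k = - coord X k j"
proof -
  have "eta (j - 1) * X $$ (j - 1, k - 1) = - (eta (k - 1) * X $$ (k - 1, j - 1))"
    using assms by (intro so_complex_entry) auto
  then show ?thesis by (simp add: coord_def mult.commute[of "basis_scale j"])
qed

text \<open>The first bivector kills every basis vector orthogonal to its own two, so by the Leibniz rule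
  the bracket of the two bivectors is 0.\<close>

lemma wedge_bvec_commute:
  assumes ne: "i \<noteq> k" "i \<noteq> l" "j \<noteq> k" "j \<noteq> l"
  shows "wedge (bvec i) (bvec j) * wedge (bvec k) (bvec l) \<approx>\<^sub>U wedge (bvec k) (bvec l)
      * wedge (bvec i) (bvec j)"
proof -
  have z: "app (omega (bvec i) (bvec j)) (bvec q) = (\<lambda>r. 0)" if "q \<noteq> i" "q \<noteq> j" for q
  proof
    fix r
    show "app (omega (bvec i) (bvec j)) (bvec q) r = 0"
      using that by (auto simp: app_def omega_def bvec_def intro!: sum.neutral)
  qed
  have "omega u (\<lambda>r. 0) = 0\<^sub>m N N" for u
    by (auto simp: omega_def)
  then have "wedge (bvec i) (bvec j) * wedge (bvec k) (bvec l) - wedge (bvec k) (bvec l)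
      * wedge (bvec i) (bvec j)
      \<approx>\<^sub>U letter (0\<^sub>m N N)"
    using letter_bracket[OF omega_in_L omega_in_L, of "bvec i" "bvec j" "bvec k" "bvec l"] ne
    by (simp add: wedge_def omega_bracket z omega_zero_left)
  also have "\<dots> \<approx>\<^sub>U 0" by (rule letter_zero[OF omega_in_L])
  finally have "wedge (bvec i) (bvec j) * wedge (bvec k) (bvec l) - wedge (bvec k) (bvec l)
      * wedge (bvec i) (bvec j)
      + wedge (bvec k) (bvec l) * wedge (bvec i) (bvec j) \<approx>\<^sub>U 0 + wedge (bvec k) (bvec l)
          * wedge (bvec i) (bvec j)"
    by (intro ucong_add ucong_refl free_alg_mult wedge_carrier)
  then show ?thesis by simp
qed

end

section \<open>Ordered pairings as coset representatives\<close>

text \<open>A position \<open>i\<close> belongs to the block \<open>i div 2\<close>; the blocks are the factors of a product of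
  bivectors. The next two permutations exchange the positions inside one block, and two neighbouring
  blocks.\<close>

definition swap_in :: "nat \<Rightarrow> nat \<Rightarrow> nat" where
  "swap_in a = transpose (2 * a) (2 * a + 1)"

definition swap_blocks :: "nat \<Rightarrow> nat \<Rightarrow> nat" where
  "swap_blocks a = transpose (2 * a) (2 * a + 2) \<circ> transpose (2 * a + 1) (2 * a + 3)"

lemma swap_in_apply:
  "swap_in a i = (if i = 2 * a then 2 * a + 1 else if i = 2 * a + 1 then 2 * a else i)"
  by (simp add: swap_in_def transpose_def)

lemma swap_blocks_apply:
  "swap_blocks a i = (if i = 2 * a then 2 * a + 2 else if i = 2 * a + 1 then 2 * a + 3
     else if i = 2 * a + 2 then 2 * a else if i = 2 * a + 3 then 2 * a + 1 else i)"
  by (simp add: swap_blocks_def transpose_def)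

lemma swap_in_permutes: "a < p \<Longrightarrow> swap_in a permutes {..<2 * p}"
  unfolding swap_in_def by (rule permutes_swap_id) auto

lemma swap_blocks_permutes: "Suc a < p \<Longrightarrow> swap_blocks a permutes {..<2 * p}"
  unfolding swap_blocks_def by (intro permutes_compose permutes_swap_id) auto

lemma swap_in_involutive: "swap_in a \<circ> swap_in a = id"
  by (simp add: swap_in_def)

lemma swap_blocks_involutive: "swap_blocks a \<circ> swap_blocks a = id"
  by (auto simp: fun_eq_iff swap_blocks_apply)

lemma sign_swap_in: "sign (swap_in a) = - 1"
  unfolding swap_in_def by (subst sign_swap_id) simp

lemma sign_swap_blocks: "sign (swap_blocks a) = 1"
  unfolding swap_blocks_def
  by (subst sign_compose) (simp_all add: permutation_swap_id sign_swap_id)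

text \<open>The group of permutations of \<open>2p\<close> positions that permute the \<open>p\<close> blocks, given by generators
  because invariance of a product of bivectors is checked on these.\<close>

inductive block_perm :: "nat \<Rightarrow> (nat \<Rightarrow> nat) \<Rightarrow> bool" for p where
  id: "block_perm p id"
| swap_in: "block_perm p b \<Longrightarrow> a < p \<Longrightarrow> block_perm p (b \<circ> swap_in a)"
| swap_blocks: "block_perm p b \<Longrightarrow> Suc a < p \<Longrightarrow> block_perm p (b \<circ> swap_blocks a)"

lemma block_perm_permutes: "block_perm p b \<Longrightarrow> b permutes {..<2 * p}"
proof (induction rule: block_perm.induct)
  case id
  show ?case by (rule permutes_id)
next
  case (swap_in b a)
  show ?case by (rule permutes_compose[OF swap_in_permutes[OF swap_in.hyps(2)] swap_in.IH])
next
  case (swap_blocks b a)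
  show ?case by (rule permutes_compose[OF swap_blocks_permutes[OF swap_blocks.hyps(2)]
      swap_blocks.IH])
qed

lemma block_perm_comp:
  assumes "block_perm p b" "block_perm p c" shows "block_perm p (b \<circ> c)"
  using assms(2)
proof (induction rule: block_perm.induct)
  case id
  show ?case unfolding comp_id by (rule assms(1))
next
  case (swap_in c a)
  show ?case
    unfolding comp_assoc[symmetric] by (rule block_perm.swap_in[OF swap_in.IH swap_in.hyps(2)])
next
  case (swap_blocks c a)
  show ?case
    unfolding comp_assoc[symmetric]
    by (rule block_perm.swap_blocks[OF swap_blocks.IH swap_blocks.hyps(2)])
qed

lemma block_perm_inverse:
  assumes "block_perm p b" shows "\<exists>c. block_perm p c \<and> b \<circ> c = id"
  using assms
proof (induction rule: block_perm.induct)
  case id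
  show ?case by (intro exI[of _ id] conjI block_perm.id comp_id)
next
  case (swap_in b a)
  then obtain c where c: "block_perm p c" "b \<circ> c = id" by blast
  have "b \<circ> swap_in a \<circ> (swap_in a \<circ> c) = b \<circ> (swap_in a \<circ> swap_in a) \<circ> c"
    by (simp add: comp_assoc)
  also have "\<dots> = id" unfolding swap_in_involutive comp_id by (rule c(2))
  finally have "b \<circ> swap_in a \<circ> (swap_in a \<circ> c) = id" .
  moreover have "block_perm p (swap_in a \<circ> c)"
    using block_perm_comp[OF block_perm.swap_in[OF block_perm.id swap_in.hyps(2)] c(1)] by simp
  ultimately show ?case by blast
next
  case (swap_blocks b a)
  then obtain c where c: "block_perm p c" "b \<circ> c = id" by blast
  have "b \<circ> swap_blocks a \<circ> (swap_blocks a \<circ> c) = b \<circ> (swap_blocks a \<circ> swap_blocks a) \<circ> c"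
    by (simp add: comp_assoc)
  also have "\<dots> = id" unfolding swap_blocks_involutive comp_id by (rule c(2))
  finally have "b \<circ> swap_blocks a \<circ> (swap_blocks a \<circ> c) = id" .
  moreover have "block_perm p (swap_blocks a \<circ> c)"
    using block_perm_comp[OF block_perm.swap_blocks[OF block_perm.id swap_blocks.hyps(2)] c(1)] by
        simp
  ultimately show ?case by blast
qed

lemma block_perm_finite: "finite {b. block_perm p b}"
  by (rule finite_subset[OF _ finite_permutations[of "{..<2 * p}"]])
    (auto intro: block_perm_permutes)

lemma block_perm_blocks:
  assumes "block_perm p b"
  shows "\<exists>\<pi>. \<pi> permutes {..<p} \<and> (\<forall>i. b i div 2 = \<pi> (i div 2))"
  using assms
proof (induction rule: block_perm.induct)
  case id
  show ?case by (intro exI[of _ id] conjI permutes_id) simp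
next
  case (swap_in b a)
  then obtain \<pi> where \<pi>: "\<pi> permutes {..<p}" "\<And>i. b i div 2 = \<pi> (i div 2)" by blast
  have "swap_in a i div 2 = i div 2" for i by (auto simp: swap_in_apply)
  with \<pi> show ?case by auto
next
  case (swap_blocks b a)
  then obtain \<pi> where \<pi>: "\<pi> permutes {..<p}" "\<And>i. b i div 2 = \<pi> (i div 2)" by blast
  have "swap_blocks a i div 2 = transpose a (Suc a) (i div 2)" for i
    by (simp add: swap_blocks_apply transpose_def) presburger
  moreover have "\<pi> \<circ> transpose a (Suc a) permutes {..<p}"
    using \<pi>(1) swap_blocks.hyps by (intro permutes_compose permutes_swap_id) auto
  moreover have "(b \<circ> swap_blocks a) i div 2 = (\<pi> \<circ> transpose a (Suc a)) (i div 2)" for i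
    using \<pi>(2) calculation(1) by simp
  ultimately show ?case by blast
qed

text \<open>The set \<open>P\<^sub>+\<close> for permutations of positions instead of index sequences.\<close>

definition ordered_pairings :: "nat \<Rightarrow> (nat \<Rightarrow> nat) set" where
  "ordered_pairings p = {\<tau>. \<tau> permutes {..<2 * p} \<and>
     (\<forall>a. a + 1 < p \<longrightarrow> \<tau> (2 * a) < \<tau> (2 * (a + 1))) \<and> (\<forall>a<p. \<tau> (2 * a) < \<tau> (2 * a + 1))}"

lemma ordered_pairings_mono:
  assumes "\<tau> \<in> ordered_pairings p" "a < b" "b < p" shows "\<tau> (2 * a) < \<tau> (2 * b)"
  using assms(2,3)
proof (induction b)
  case (Suc b)
  then have "\<tau> (2 * b) < \<tau> (2 * (b + 1))"
    using assms(1) by (auto simp: ordered_pairings_def)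
  with Suc show ?case by (cases "a = b") auto
qed simp

text \<open>Inside each block the order prescribes which position comes first, so \<open>b\<close> preserves the
  order in every block; comparing the first entries of the blocks, the permutation that \<open>b\<close> induces
  on the blocks is increasing and hence trivial.\<close>

lemma ordered_pairings_unique:
  assumes \<sigma>: "\<sigma> \<in> ordered_pairings p" and b: "block_perm p b"
    and \<sigma>b: "\<sigma> \<circ> b \<in> ordered_pairings p"
  shows "b = id"
proof -
  obtain \<pi> where \<pi>: "\<pi> permutes {..<p}" "\<And>i. b i div 2 = \<pi> (i div 2)"
    using block_perm_blocks[OF b] by blast
  have bp: "b permutes {..<2 * p}" by (rule block_perm_permutes[OF b])
  have blk: "b (2 * a) = 2 * \<pi> a \<and> b (2 * a + 1) = 2 * \<pi> a + 1" if a: "a < p" for a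
  proof -
    have d: "b (2 * a) div 2 = \<pi> a" "b (2 * a + 1) div 2 = \<pi> a"
      using \<pi>(2)[of "2 * a"] \<pi>(2)[of "2 * a + 1"] by auto
    have ne: "b (2 * a) \<noteq> b (2 * a + 1)"
      by (simp add: inj_eq[OF permutes_inj[OF bp]])
    have "\<pi> a < p" using permutes_in_image[OF \<pi>(1), of a] a by simp
    then have s: "\<sigma> (2 * \<pi> a) < \<sigma> (2 * \<pi> a + 1)"
      using \<sigma> by (auto simp: ordered_pairings_def)
    have s': "\<sigma> (b (2 * a)) < \<sigma> (b (2 * a + 1))"
      using \<sigma>b a by (auto simp: ordered_pairings_def)
    have "b (2 * a) = 2 * \<pi> a \<and> b (2 * a + 1) = 2 * \<pi> a + 1
        \<or> b (2 * a) = 2 * \<pi> a + 1 \<and> b (2 * a + 1) = 2 * \<pi> a"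
      using d ne by presburger
    with s s' show ?thesis by auto
  qed
  have mono: "\<pi> a < \<pi> c" if "a < c" "c < p" for a c
  proof (rule ccontr)
    assume "\<not> \<pi> a < \<pi> c"
    moreover have "\<pi> a \<noteq> \<pi> c"
      using that by (simp add: inj_eq[OF permutes_inj[OF \<pi>(1)]])
    ultimately have "\<pi> c < \<pi> a" by simp
    moreover have "\<pi> a < p" using permutes_in_image[OF \<pi>(1), of a] that by simp
    ultimately have "\<sigma> (2 * \<pi> c) < \<sigma> (2 * \<pi> a)"
      by (rule ordered_pairings_mono[OF \<sigma>])
    moreover have "\<sigma> (2 * \<pi> a) < \<sigma> (2 * \<pi> c)"
      using ordered_pairings_mono[OF \<sigma>b that] blk that by simp
    ultimately show False by simp
  qed
  have "a \<le> \<pi> a" if "a < p" for a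
    using that
  proof (induction a)
    case (Suc a)
    then show ?case using mono[of a "Suc a"] by simp
  qed simp
  then have "\<pi> = id"
    using permutes_natset_ge[of \<pi> "{..<p}"] \<pi>(1) by blast
  show "b = id"
  proof
    fix i
    show "b i = id i"
    proof (cases "i < 2 * p")
      case True
      have "i = 2 * (i div 2) \<or> i = 2 * (i div 2) + 1" by presburger
      moreover have "i div 2 < p" using True by auto
      ultimately show ?thesis
        using blk[of "i div 2"] \<open>\<pi> = id\<close> by auto
    next
      case False
      then show ?thesis using permutes_not_in[OF bp] by simp
    qed
  qed
qed

text \<open>Bubble sort. The first entries of the blocks, summed with decreasing weights \<open>p - a\<close>, bound
  the number of exchanges: putting the smaller entry of a block first decreases one summand, and
  putting the block with the smaller first entry first moves the larger value to a smaller weight.\<close>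

lemma ordered_pairings_exist:
  assumes "\<tau> permutes {..<2 * p}"
  shows "\<exists>b. block_perm p b \<and> \<tau> \<circ> b \<in> ordered_pairings p"
  using assms
proof (induction "\<Sum>a<p. (p - a) * \<tau> (2 * a)" arbitrary: \<tau> rule: less_induct)
  case less
  have step: ?case if g: "block_perm p g" "g permutes {..<2 * p}"
    and lt: "(\<Sum>a<p. (p - a) * (\<tau> \<circ> g) (2 * a)) < (\<Sum>a<p. (p - a) * \<tau> (2 * a))" for g
  proof -
    obtain b where "block_perm p b" "(\<tau> \<circ> g) \<circ> b \<in> ordered_pairings p"
      using less.hyps[OF lt] permutes_compose[OF g(2) less.prems] by blast
    then show ?thesis
      using block_perm_comp[OF g(1)] by (intro exI[of _ "g \<circ> b"]) (simp_all add: comp_assoc)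
  qed
  have inj: "\<tau> i \<noteq> \<tau> j" if "i \<noteq> j" for i j
    using that by (simp add: inj_eq[OF permutes_inj[OF less.prems]])
  have swap: "\<not> \<tau> i < \<tau> j \<Longrightarrow> \<tau> j < \<tau> i" if "i \<noteq> j" for i j
    using inj[OF that] by simp
  have "\<not> \<tau> (2 * a) < \<tau> (2 * a + 1) \<Longrightarrow> \<tau> (2 * a + 1) < \<tau> (2 * a)"
    "\<not> \<tau> (2 * a) < \<tau> (2 * (a + 1)) \<Longrightarrow> \<tau> (2 * (a + 1)) < \<tau> (2 * a)" for a
    by (rule swap; simp)+
  then consider (ord) "\<tau> \<in> ordered_pairings p"
    | (inner) a where "a < p" "\<tau> (2 * a + 1) < \<tau> (2 * a)"
    | (outer) a where "a + 1 < p" "\<tau> (2 * (a + 1)) < \<tau> (2 * a)"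
    using less.prems unfolding ordered_pairings_def by blast
  then show ?case
  proof cases
    case ord
    then show ?thesis by (intro exI[of _ id] conjI block_perm.id) simp
  next
    case (inner a)
    show ?thesis
    proof (rule step[of "swap_in a"])
      show "block_perm p (swap_in a)"
        using block_perm.swap_in[OF block_perm.id inner(1)] by simp
      have "(\<Sum>c<p. (p - c) * (\<tau> \<circ> swap_in a) (2 * c)) =
          (p - a) * \<tau> (2 * a + 1) + (\<Sum>c\<in>{..<p} - {a}. (p - c) * \<tau> (2 * c))"
        using inner(1) by (subst sum.remove[of _ a]) (auto simp: swap_in_apply intro!: sum.cong)
      also have "\<dots> < (p - a) * \<tau> (2 * a) + (\<Sum>c\<in>{..<p} - {a}. (p - c) * \<tau> (2 * c))"
        using inner by simp
      also have "\<dots> = (\<Sum>c<p. (p - c) * \<tau> (2 * c))"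
        using inner(1) by (subst sum.remove[of _ a]) auto
      finally show "(\<Sum>c<p. (p - c) * (\<tau> \<circ> swap_in a) (2 * c)) < (\<Sum>c<p. (p - c) * \<tau> (2 * c))" .
    qed (use inner in \<open>auto intro: swap_in_permutes\<close>)
  next
    case (outer a)
    obtain k where k: "p - a = Suc k" "p - Suc a = k"
      using outer(1) by (metis Suc_diff_Suc Suc_eq_plus1 Suc_lessD)
    have split: "(\<Sum>c<p. f c) = f a + (f (Suc a) + (\<Sum>c\<in>{..<p} - {a} - {Suc a}. f c))"
      for f :: "nat \<Rightarrow> nat"
      using outer(1) by (simp add: sum.remove[of "{..<p}" a] sum.remove[of "{..<p} - {a}" "Suc a"])
    show ?thesis
    proof (rule step[of "swap_blocks a"])
      show "block_perm p (swap_blocks a)"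
        using block_perm.swap_blocks[OF block_perm.id, of a p] outer(1) by simp
      have "(\<Sum>c<p. (p - c) * (\<tau> \<circ> swap_blocks a) (2 * c)) =
          Suc k * \<tau> (2 * a + 2) + (k * \<tau> (2 * a) + (\<Sum>c\<in>{..<p} - {a} - {Suc a}. (p - c) * \<tau> (2 * c)))"
        unfolding split k
        by (intro arg_cong2[of _ _ _ _ "(+)"] sum.cong) (auto simp: swap_blocks_apply)
      also have "\<dots> < Suc k * \<tau> (2 * a) + (k * \<tau> (2 * a + 2) + (\<Sum>c\<in>{..<p} - {a} - {Suc a}. (p - c)
          * \<tau> (2 * c)))"
        using outer(2) by simp
      also have "\<dots> = (\<Sum>c<p. (p - c) * \<tau> (2 * c))"
        unfolding split k by simp
      finally show "(\<Sum>c<p. (p - c) * (\<tau> \<circ> swap_blocks a) (2 * c)) < (\<Sum>c<p. (p - c) * \<tau> (2 * c))" .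
    qed (use outer in \<open>auto intro: swap_blocks_permutes\<close>)
  qed
qed

text \<open>Every left coset of the block permutations contains exactly one ordered pairing.\<close>

lemma permutations_factorization:
  "bij_betw (\<lambda>(\<sigma>, b). \<sigma> \<circ> b) (ordered_pairings p \<times> {b. block_perm p b}) {\<tau>. \<tau> permutes {..<2 * p}}"
proof (rule bij_betw_imageI)
  have perm: "\<sigma> \<in> ordered_pairings p \<Longrightarrow> \<sigma> permutes {..<2 * p}" for \<sigma>
    by (simp add: ordered_pairings_def)
  show "inj_on (\<lambda>(\<sigma>, b). \<sigma> \<circ> b) (ordered_pairings p \<times> {b. block_perm p b})"
  proof (rule inj_onI, clarify)
    fix \<sigma> b \<sigma>' b'
    assume *: "\<sigma> \<in> ordered_pairings p" "block_perm p b" "\<sigma>' \<in> ordered_pairings p"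
      "block_perm p b'" "\<sigma> \<circ> b = \<sigma>' \<circ> b'"
    obtain c where c: "block_perm p c" "b' \<circ> c = id"
      using block_perm_inverse[OF *(4)] by blast
    have "\<sigma>' = \<sigma>' \<circ> (b' \<circ> c)" using c(2) by simp
    also have "\<dots> = \<sigma> \<circ> (b \<circ> c)"
      using *(5) by (simp add: comp_assoc[symmetric])
    finally have e: "\<sigma>' = \<sigma> \<circ> (b \<circ> c)" .
    have "b \<circ> c = id"
      using ordered_pairings_unique[OF *(1) block_perm_comp[OF *(2) c(1)]] e *(3) by simp
    with e have "\<sigma> = \<sigma>'" by simp
    moreover have "b = b'"
    proof
      fix x
      show "b x = b' x"
        using *(5) permutes_inj[OF perm[OF *(1)]] \<open>\<sigma> = \<sigma>'\<close>
        by (metis comp_apply injD)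
    qed
    ultimately show "\<sigma> = \<sigma>' \<and> b = b'" by simp
  qed
  show "(\<lambda>(\<sigma>, b). \<sigma> \<circ> b) ` (ordered_pairings p \<times> {b. block_perm p b}) = {\<tau>. \<tau> permutes {..<2 * p}}"
  proof (intro equalityI subsetI)
    fix \<tau> assume "\<tau> \<in> (\<lambda>(\<sigma>, b). \<sigma> \<circ> b) ` (ordered_pairings p \<times> {b. block_perm p b})"
    then obtain \<sigma> b where "\<sigma> \<in> ordered_pairings p" "block_perm p b" "\<tau> = \<sigma> \<circ> b" by auto
    then show "\<tau> \<in> {\<tau>. \<tau> permutes {..<2 * p}}"
      using permutes_compose[OF block_perm_permutes perm] by simp
  next
    fix \<tau> assume "\<tau> \<in> {\<tau>. \<tau> permutes {..<2 * p}}"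
    then obtain b where b: "block_perm p b" "\<tau> \<circ> b \<in> ordered_pairings p"
      using ordered_pairings_exist by blast
    obtain c where c: "block_perm p c" "b \<circ> c = id"
      using block_perm_inverse[OF b(1)] by blast
    have "\<tau> = (\<tau> \<circ> b) \<circ> c" using c(2) by (simp add: comp_assoc)
    then show "\<tau> \<in> (\<lambda>(\<sigma>, b). \<sigma> \<circ> b) ` (ordered_pairings p \<times> {b. block_perm p b})"
      using b(2) c(1) by (intro image_eqI[of _ _ "(\<tau> \<circ> b, c)"]) auto
  qed
qed

text \<open>As \<open>I\<close> is increasing, relabelling the positions \<open>0, \<dots>, 2p - 1\<close> by the entries of \<open>I\<close> preserves
  all the inequalities; being a conjugation it also preserves signs.\<close>

lemma ordered_pairings_bij_P_plus:
  assumes I: "I \<in> T_seq (2 * p) N"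
  shows "bij_betw (map_permutation {..<2 * p} ((!) I)) (ordered_pairings p) (P_plus p I)"
    and "\<tau> \<in> ordered_pairings p \<Longrightarrow> sign (map_permutation {..<2 * p} ((!) I) \<tau>) = sign \<tau>"
    and "\<tau> permutes {..<2 * p} \<Longrightarrow> j < 2 * p \<Longrightarrow> map_permutation {..<2 * p} ((!) I) \<tau> (I ! j) = I ! \<tau> j"
proof -
  let ?A = "{..<2 * p}" and ?f = "(!) I"
  have len: "length I = 2 * p" and srt: "sorted_wrt (<) I"
    using I unfolding T_seq_def by blast+
  have less: "I ! i < I ! j \<longleftrightarrow> i < j" if "i < 2 * p" "j < 2 * p" for i j
    using that len sorted_wrt_nth_less[OF srt, of i j] sorted_wrt_nth_less[OF srt, of j i]
    by (metis less_asym linorder_neqE_nat)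
  have inj: "inj_on ?f ?A"
    by (rule inj_onI) (metis less less_irrefl lessThan_iff linorder_neqE_nat)
  have img: "?f ` ?A = set I"
    using len by (auto simp: set_conv_nth)
  have bij: "bij_betw ?f ?A (set I)"
    using inj img by (simp add: bij_betw_def)
  show app: "map_permutation ?A ?f \<tau> (I ! j) = I ! \<tau> j" if "\<tau> permutes ?A" "j < 2 * p" for \<tau> j
    using map_permutation_apply[OF inj, of j \<tau>] that by simp
  have in_iff: "map_permutation ?A ?f \<tau> \<in> P_plus p I \<longleftrightarrow> \<tau> \<in> ordered_pairings p"
    if \<tau>: "\<tau> permutes ?A" for \<tau>
  proof -
    have lt: "\<tau> i < 2 * p" if "i < 2 * p" for i
      using permutes_in_image[OF \<tau>, of i] that by simp
    have "map_permutation ?A ?f \<tau> permutes set I"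
      by (rule map_permutation_permutes[OF bij \<tau>])
    moreover have "map_permutation ?A ?f \<tau> (I ! i) < map_permutation ?A ?f \<tau> (I ! j) \<longleftrightarrow> \<tau> i < \<tau> j"
      if "i < 2 * p" "j < 2 * p" for i j
      using that by (simp add: app[OF \<tau>] less lt)
    ultimately show ?thesis
      using \<tau> by (auto simp: P_plus_def ordered_pairings_def)
  qed
  show "sign (map_permutation ?A ?f \<tau>) = sign \<tau>" if "\<tau> \<in> ordered_pairings p"
    using that by (intro sign_map_permutation inj) (auto simp: ordered_pairings_def)
  show "bij_betw (map_permutation ?A ?f) (ordered_pairings p) (P_plus p I)"
  proof (rule bij_betw_imageI)
    show "inj_on (map_permutation ?A ?f) (ordered_pairings p)"
    proof (rule inj_onI)
      fix \<sigma> \<tau> assume *: "\<sigma> \<in> ordered_pairings p" "\<tau> \<in> ordered_pairings p"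
        "map_permutation ?A ?f \<sigma> = map_permutation ?A ?f \<tau>"
      then have perm: "\<sigma> permutes ?A" "\<tau> permutes ?A" by (auto simp: ordered_pairings_def)
      show "\<sigma> = \<tau>"
      proof
        fix i
        show "\<sigma> i = \<tau> i"
        proof (cases "i < 2 * p")
          case True
          then have "I ! \<sigma> i = I ! \<tau> i"
            using app[OF perm(1)] app[OF perm(2)] *(3) by metis
          then show ?thesis
            using inj True permutes_in_image[OF perm(1), of i] permutes_in_image[OF perm(2), of i]
            by (auto dest: inj_onD)
        next
          case False
          then show ?thesis using permutes_not_in[OF perm(1)] permutes_not_in[OF perm(2)] by simp
        qed
      qed
    qed
    show "map_permutation ?A ?f ` ordered_pairings p = P_plus p I"
    proof (intro equalityI subsetI)
      fix \<sigma> assume "\<sigma> \<in> map_permutation ?A ?f ` ordered_pairings p"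
      then show "\<sigma> \<in> P_plus p I" using in_iff by (auto simp: ordered_pairings_def)
    next
      fix \<sigma> assume \<sigma>: "\<sigma> \<in> P_plus p I"
      then have perm: "\<sigma> permutes set I" by (simp add: P_plus_def)
      let ?\<tau> = "map_permutation (set I) (inv_into ?A ?f) \<sigma>"
      have b': "bij_betw (inv_into ?A ?f) (set I) ?A" by (rule bij_betw_inv_into[OF bij])
      have \<tau>: "?\<tau> permutes ?A" by (rule map_permutation_permutes[OF b' perm])
      have e: "map_permutation ?A ?f ?\<tau> = \<sigma>"
        by (rule map_permutation_compose_inv[OF b' perm]) (auto simp: img f_inv_into_f)
      have "?\<tau> \<in> ordered_pairings p"
        unfolding in_iff[OF \<tau>, symmetric] e by (rule \<sigma>)
      then have "map_permutation ?A ?f ?\<tau> \<in> map_permutation ?A ?f ` ordered_pairings p"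
        by (rule imageI)
      then show "\<sigma> \<in> map_permutation ?A ?f ` ordered_pairings p"
        unfolding e .
    qed
  qed
qed

section \<open>The elements \<open>W\<^sub>I\<close> as normalised Pfaffians\<close>

lemma T_seq_finite: "finite (T_seq s k)"
  by (rule finite_subset[OF _ finite_lists_length_eq[of "{1..k}" s]]) (auto simp: T_seq_def)

lemma T_seq_nth:
  assumes "I \<in> T_seq s k" "j < s" shows "I ! j \<in> {1..k}"
  using assms unfolding T_seq_def by (blast intro: nth_mem)

lemma T_seq_inj_on: "I \<in> T_seq s k \<Longrightarrow> inj_on ((!) I) {..<s}"
  unfolding T_seq_def
  by (intro inj_onI) (simp add: nth_eq_iff_index_eq strict_sorted_iff)

lemma T_seq_eqI: "I \<in> T_seq s k \<Longrightarrow> J \<in> T_seq s k \<Longrightarrow> set I = set J \<Longrightarrow> I = J"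
  unfolding T_seq_def by (blast intro: strict_sorted_equal)

lemma T_seq_image_nth: "I \<in> T_seq s k \<Longrightarrow> (!) I ` {..<s} = set I"
  by (auto simp: T_seq_def set_conv_nth)

text \<open>Sort the entries of the tuple; \<open>\<pi>\<close> records where they came from.\<close>

lemma injective_tuple_factorization:
  assumes inj: "inj_on K {..<s}" and K: "\<And>j. j < s \<Longrightarrow> K j \<in> {1..k}"
  obtains I \<pi> where "I \<in> T_seq s k" "\<pi> permutes {..<s}" "\<And>j. j < s \<Longrightarrow> K j = I ! \<pi> j"
proof -
  define I where "I = sorted_list_of_set (K ` {..<s})"
  have set: "set I = K ` {..<s}" by (simp add: I_def)
  have len: "length I = s"
    using card_image[OF inj] by (simp add: I_def)
  have I: "I \<in> T_seq s k"
    unfolding T_seq_def using K by (auto simp: set len) (simp add: I_def)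
  have bI: "bij_betw ((!) I) {..<s} (set I)"
    using T_seq_inj_on[OF I] T_seq_image_nth[OF I] by (simp add: bij_betw_def)
  define \<pi> where "\<pi> = (\<lambda>j. if j < s then inv_into {..<s} ((!) I) (K j) else j)"
  have bK: "bij_betw K {..<s} (set I)"
    using inj by (simp add: bij_betw_def set)
  have "bij_betw (inv_into {..<s} ((!) I) \<circ> K) {..<s} {..<s}"
    by (rule bij_betw_trans[OF bK bij_betw_inv_into[OF bI]])
  then have "bij_betw \<pi> {..<s} {..<s}"
    by (rule bij_betw_cong[THEN iffD1, rotated]) (simp add: \<pi>_def)
  then have "\<pi> permutes {..<s}"
    by (rule bij_imp_permutes) (simp add: \<pi>_def)
  moreover have "K j = I ! \<pi> j" if "j < s" for j
  proof -
    have "K j \<in> (!) I ` {..<s}" using that T_seq_image_nth[OF I] set by simp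
    from f_inv_into_f[OF this] show ?thesis using that by (simp add: \<pi>_def)
  qed
  ultimately show ?thesis using that I by blast
qed

context signature
begin

lemma pair_prod_swap_in:
  assumes "a < p" shows "pair_prod p (v \<circ> swap_in a) \<approx>\<^sub>U - pair_prod p v"
  using assms
proof (induction p)
  case (Suc p)
  show ?case
  proof (cases "a < p")
    case True
    then have "pair_prod (Suc p) (v \<circ> swap_in a) = pair_prod p (v \<circ> swap_in a) * wedge (v (2
        * p)) (v (2 * p + 1))"
      by (simp add: swap_in_apply)
    also have "\<dots> \<approx>\<^sub>U - pair_prod p v * wedge (v (2 * p)) (v (2 * p + 1))"
      by (rule ucong_mult[OF Suc.IH[OF True] ucong_refl[OF wedge_carrier]])
    also have "\<dots> = - pair_prod (Suc p) v" by simp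
    finally show ?thesis .
  next
    case False
    then have a: "a = p" using Suc.prems by simp
    have "pair_prod p (v \<circ> swap_in a) = pair_prod p v"
      by (rule pair_prod_cong) (simp add: a swap_in_apply)
    then have "pair_prod (Suc p) (v \<circ> swap_in a) = pair_prod p v * wedge (v (2 * p + 1)) (v (2 * p))"
      by (simp add: a swap_in_apply)
    also have "\<dots> \<approx>\<^sub>U pair_prod p v * - wedge (v (2 * p)) (v (2 * p + 1))"
      by (rule ucong_mult[OF ucong_refl[OF pair_prod_carrier] wedge_swap])
    also have "\<dots> = - pair_prod (Suc p) v" by simp
    finally show ?thesis .
  qed
qed simp

lemma pair_prod_swap_blocks:
  assumes "Suc a < p"
    and comm: "wedge (v (2 * a + 2)) (v (2 * a + 3)) * wedge (v (2 * a)) (v (2 * a + 1))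
      \<approx>\<^sub>U wedge (v (2 * a)) (v (2 * a + 1)) * wedge (v (2 * a + 2)) (v (2 * a + 3))"
  shows "pair_prod p (v \<circ> swap_blocks a) \<approx>\<^sub>U pair_prod p v"
  using assms(1)
proof (induction p)
  case (Suc p)
  show ?case
  proof (cases "Suc a < p")
    case True
    then have "pair_prod (Suc p) (v \<circ> swap_blocks a)
        = pair_prod p (v \<circ> swap_blocks a) * wedge (v (2 * p)) (v (2 * p + 1))"
      by (simp add: swap_blocks_apply)
    also have "\<dots> \<approx>\<^sub>U pair_prod p v * wedge (v (2 * p)) (v (2 * p + 1))"
      by (rule ucong_mult[OF Suc.IH[OF True] ucong_refl[OF wedge_carrier]])
    also have "\<dots> = pair_prod (Suc p) v" by simp
    finally show ?thesis .
  next
    case False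
    then have p: "p = Suc a" using Suc.prems by simp
    have "pair_prod a (v \<circ> swap_blocks a) = pair_prod a v"
      by (rule pair_prod_cong) (simp add: swap_blocks_apply)
    then have "pair_prod (Suc p) (v \<circ> swap_blocks a) = pair_prod a v *
        (wedge (v (2 * a + 2)) (v (2 * a + 3)) * wedge (v (2 * a)) (v (2 * a + 1)))"
      by (simp add: p swap_blocks_apply mult.assoc)
    also have "\<dots> \<approx>\<^sub>U pair_prod a v * (wedge (v (2 * a)) (v (2 * a + 1)) * wedge (v (2 * a
        + 2)) (v (2 * a + 3)))"
      by (rule ucong_mult[OF ucong_refl[OF pair_prod_carrier] comm])
    also have "\<dots> = pair_prod (Suc p) v"
      by (simp add: p mult.assoc numeral_3_eq_3)
    finally show ?thesis .
  qed
qed simp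

definition basis_tuple :: "(nat \<Rightarrow> nat) \<Rightarrow> nat \<Rightarrow> nat \<Rightarrow> complex" where
  "basis_tuple K = (\<lambda>j. bvec (K j))"

lemma basis_tuple_comp: "basis_tuple K \<circ> \<tau> = basis_tuple (K \<circ> \<tau>)"
  by (simp add: basis_tuple_def fun_eq_iff)

text \<open>Exchanging the entries of a bivector changes both signs; exchanging two blocks is an even
  permutation, and the two bivectors commute because their indices are distinct.\<close>

lemma pair_prod_block_perm:
  assumes b: "block_perm p b" and K: "inj_on K {..<2 * p}"
  shows "scalar (of_int (sign b)) * pair_prod p (basis_tuple K \<circ> b) \<approx>\<^sub>U pair_prod p (basis_tuple K)"
  using b
proof (induction rule: block_perm.induct)
  case id
  show ?case unfolding comp_id sign_id of_int_1 scalar_one mult_1_left by (rule ucong_refl[OF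
      pair_prod_carrier])
next
  case (swap_in b a)
  have "sign (b \<circ> swap_in a) = - sign b"
    using block_perm_permutes[OF swap_in.hyps(1)] swap_in_permutes[OF swap_in.hyps(2)]
    by (subst sign_compose) (auto simp: sign_swap_in permutation_permutes)
  then have "scalar (of_int (sign (b \<circ> swap_in a))) * pair_prod p (basis_tuple K \<circ> (b \<circ> swap_in a))
      = scalar (of_int (sign b)) * - pair_prod p ((basis_tuple K \<circ> b) \<circ> swap_in a)"
    unfolding comp_assoc by (simp add: scalar_uminus)
  also have "\<dots> \<approx>\<^sub>U scalar (of_int (sign b)) * - (- pair_prod p (basis_tuple K \<circ> b))"
    by (intro ucong_scalar ucong_uminus pair_prod_swap_in swap_in.hyps)
  also have "\<dots> \<approx>\<^sub>U pair_prod p (basis_tuple K)"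
    unfolding minus_minus by (rule swap_in.IH)
  finally show ?case .
next
  case (swap_blocks b a)
  have "sign (b \<circ> swap_blocks a) = sign b"
    using block_perm_permutes[OF swap_blocks.hyps(1)] swap_blocks_permutes[OF swap_blocks.hyps(2)]
    by (subst sign_compose) (auto simp: sign_swap_blocks permutation_permutes)
  then have "scalar (of_int (sign (b \<circ> swap_blocks a))) * pair_prod p (basis_tuple K \<circ> (b \<circ>
      swap_blocks a))
      = scalar (of_int (sign b)) * pair_prod p ((basis_tuple K \<circ> b) \<circ> swap_blocks a)"
    unfolding comp_assoc by simp
  also have "\<dots> \<approx>\<^sub>U scalar (of_int (sign b)) * pair_prod p (basis_tuple K \<circ> b)"
  proof (intro ucong_scalar pair_prod_swap_blocks swap_blocks.hyps)
    have perm: "b permutes {..<2 * p}" by (rule block_perm_permutes[OF swap_blocks.hyps(1)])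
    have ne: "K (b i) \<noteq> K (b j)" if "i < 2 * p" "j < 2 * p" "i \<noteq> j" for i j
    proof
      assume "K (b i) = K (b j)"
      then have "b i = b j"
        using inj_onD[OF K] permutes_in_image[OF perm, of i] permutes_in_image[OF perm, of j] that
        by simp
      then show False using that(3) by (simp add: inj_eq[OF permutes_inj[OF perm]])
    qed
    show "wedge ((basis_tuple K \<circ> b) (2 * a + 2)) ((basis_tuple K \<circ> b) (2 * a + 3))
        * wedge ((basis_tuple K \<circ> b) (2 * a)) ((basis_tuple K \<circ> b) (2 * a + 1))
      \<approx>\<^sub>U wedge ((basis_tuple K \<circ> b) (2 * a)) ((basis_tuple K \<circ> b) (2 * a + 1))
          * wedge ((basis_tuple K \<circ> b) (2 * a + 2)) ((basis_tuple K \<circ> b) (2 * a + 3))"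
      unfolding basis_tuple_def comp_apply
      by (rule wedge_bvec_commute; rule ne) (use swap_blocks.hyps(2) in auto)
  qed
  also have "\<dots> \<approx>\<^sub>U pair_prod p (basis_tuple K)" by (rule swap_blocks.IH)
  finally show ?case .
qed

abbreviation num_block_perms :: "nat \<Rightarrow> complex" where
  "num_block_perms p \<equiv> of_nat (card {b. block_perm p b})"

lemma num_block_perms_nonzero: "num_block_perms p \<noteq> 0"
  using block_perm.id[of p] block_perm_finite[of p] by (auto simp: card_eq_0_iff)

text \<open>All summands of a coset of the block permutations agree, so each coset contributes its
  representative as often as there are block permutations.\<close>

lemma pfaffian_eq_sum_ordered_pairings:
  assumes K: "inj_on K {..<2 * p}"
  shows "pfaffian p (basis_tuple K) \<approx>\<^sub>U scalar (num_block_perms p) *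
    (\<Sum>\<sigma>\<in>ordered_pairings p. scalar (of_int (sign \<sigma>)) * pair_prod p (basis_tuple K \<circ> \<sigma>))"
proof -
  let ?f = "\<lambda>\<tau>. scalar (of_int (sign \<tau>)) * pair_prod p (basis_tuple K \<circ> \<tau>)"
  have "pfaffian p (basis_tuple K) = (\<Sum>(\<sigma>, b)\<in>ordered_pairings p \<times> {b. block_perm p b}. ?f (\<sigma> \<circ> b))"
    unfolding pfaffian_def sum.reindex_bij_betw[OF permutations_factorization, symmetric]
    by (intro sum.cong) auto
  also have "\<dots> = (\<Sum>\<sigma>\<in>ordered_pairings p. \<Sum>b | block_perm p b. ?f (\<sigma> \<circ> b))"
    by (simp add: sum.cartesian_product)
  also have "\<dots> \<approx>\<^sub>U (\<Sum>\<sigma>\<in>ordered_pairings p. \<Sum>b | block_perm p b. ?f \<sigma>)"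
  proof (intro ucong_sum)
    fix \<sigma> b assume "\<sigma> \<in> ordered_pairings p" "b \<in> {b. block_perm p b}"
    then have \<sigma>: "\<sigma> permutes {..<2 * p}" and b: "block_perm p b"
      by (simp_all add: ordered_pairings_def)
    have "sign (\<sigma> \<circ> b) = sign \<sigma> * sign b"
      using \<sigma> block_perm_permutes[OF b]
      by (intro sign_compose) (auto simp: permutation_permutes)
    then have "?f (\<sigma> \<circ> b)
        = scalar (of_int (sign \<sigma>)) * (scalar (of_int (sign b)) * pair_prod p (basis_tuple (K \<circ> \<sigma>)
            \<circ> b))"
      by (simp add: basis_tuple_comp comp_assoc mult.assoc[symmetric] scalar_mult)
    also have "\<dots> \<approx>\<^sub>U scalar (of_int (sign \<sigma>)) * pair_prod p (basis_tuple (K \<circ> \<sigma>))"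
    proof (intro ucong_scalar pair_prod_block_perm b)
      show "inj_on (K \<circ> \<sigma>) {..<2 * p}"
        by (rule comp_inj_on[OF permutes_inj_on[OF \<sigma>]]) (simp add: permutes_image[OF \<sigma>] K)
    qed
    finally show "?f (\<sigma> \<circ> b) \<approx>\<^sub>U ?f \<sigma>" unfolding basis_tuple_comp .
  qed
  also have "\<dots> = scalar (num_block_perms p) * (\<Sum>\<sigma>\<in>ordered_pairings p. ?f \<sigma>)"
    by (simp add: scalar_of_nat sum_distrib_left)
  finally show ?thesis .
qed

text \<open>A representative of \<open>W\<^sub>I\<close> in the free algebra.\<close>

definition W_rep :: "nat \<Rightarrow> nat list \<Rightarrow> complex mat free_poly" where
  "W_rep p I = (\<Sum>\<sigma>\<in>P_plus p I. scalar (of_int (sign \<sigma>)) * pair_prod p (\<lambda>j. bvec (\<sigma> (I ! j))))"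

lemma W_rep_carrier [simp, intro]: "W_rep p I \<in> C"
  unfolding W_rep_def by (intro free_alg_sum free_alg_mult) auto

lemma pfaffian_eq_W_rep:
  assumes I: "I \<in> T_seq (2 * p) N"
  shows "pfaffian p (basis_tuple ((!) I)) \<approx>\<^sub>U scalar (num_block_perms p) * W_rep p I"
proof -
  let ?M = "map_permutation {..<2 * p} ((!) I)"
  have "W_rep p I = (\<Sum>\<tau>\<in>ordered_pairings p. scalar (of_int (sign (?M \<tau>))) * pair_prod p (\<lambda>j. bvec
      (?M \<tau> (I ! j))))"
    unfolding W_rep_def by (rule sum.reindex_bij_betw[OF ordered_pairings_bij_P_plus(1)[OF I],
        symmetric])
  also have "\<dots> = (\<Sum>\<tau>\<in>ordered_pairings p. scalar (of_int (sign \<tau>)) * pair_prod p (basis_tuple ((!)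
      I) \<circ> \<tau>))"
  proof (rule sum.cong[OF refl])
    fix \<tau> assume \<tau>: "\<tau> \<in> ordered_pairings p"
    then have "pair_prod p (\<lambda>j. bvec (?M \<tau> (I ! j))) = pair_prod p (basis_tuple ((!) I) \<circ> \<tau>)"
      using ordered_pairings_bij_P_plus(3)[OF I, of \<tau>]
      by (intro pair_prod_cong) (simp add: ordered_pairings_def basis_tuple_def)
    then show "scalar (of_int (sign (?M \<tau>))) * pair_prod p (\<lambda>j. bvec (?M \<tau> (I ! j)))
        = scalar (of_int (sign \<tau>)) * pair_prod p (basis_tuple ((!) I) \<circ> \<tau>)"
      using ordered_pairings_bij_P_plus(2)[OF I \<tau>] by simp
  qed
  finally show ?thesis
    using pfaffian_eq_sum_ordered_pairings[OF T_seq_inj_on[OF I]] by simp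
qed

lemma W_rep_eq_pfaffian:
  assumes I: "I \<in> T_seq (2 * p) N"
  shows "W_rep p I \<approx>\<^sub>U scalar (1 / num_block_perms p) * pfaffian p (basis_tuple ((!) I))"
proof -
  have "scalar (1 / num_block_perms p) * (scalar (num_block_perms p) * W_rep p I) = W_rep p I"
    using num_block_perms_nonzero[of p] by (simp add: mult.assoc[symmetric] scalar_mult)
  then show ?thesis
    using ucong_sym[OF ucong_scalar[OF pfaffian_eq_W_rep[OF I], of "1 / num_block_perms p"]] by simp
qed

lemma foldr_wedge:
  assumes "u \<in> carrier (uea L)"
  shows "foldr (\<lambda>a u. uea_class L (wedge (v (2 * a)) (v (2 * a + 1))) \<otimes>\<^bsub>uea L\<^esub> u) [0..<p] u
    = uea_class L (pair_prod p v) \<otimes>\<^bsub>uea L\<^esub> u"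
  using assms
proof (induction p arbitrary: u)
  case 0
  then show ?case by (simp add: uea_class_one)
next
  case (Suc p)
  have car: "uea_class L (pair_prod p v) \<in> carrier (uea L)"
    "uea_class L (wedge (v (2 * p)) (v (2 * p + 1))) \<in> carrier (uea L)"
    by (auto intro: class_hom.hom_closed)
  then show ?case
    using Suc.prems Suc.IH[OF U.m_closed[OF car(2) Suc.prems]]
    by (simp add: U.m_assoc[symmetric] uea_class_mult)
qed

lemma W_elem_eq:
  assumes I: "I \<in> T_seq (2 * p) N"
  shows "W_elem m n p I = uea_class L (W_rep p I)"
proof -
  have prod: "W_prod m n p I \<sigma> = uea_class L (pair_prod p (\<lambda>j. bvec (\<sigma> (I ! j))))"
    if \<sigma>: "\<sigma> \<in> P_plus p I" for \<sigma>
  proof -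
    have perm: "\<sigma> permutes set I" using \<sigma> by (simp add: P_plus_def)
    have range: "\<sigma> (I ! j) \<in> {1..N}" if "j < 2 * p" for j
    proof -
      have "I ! j \<in> set I" using I that by (simp add: T_seq_def)
      then have "\<sigma> (I ! j) \<in> set I" using permutes_in_image[OF perm] by blast
      then show ?thesis using I unfolding T_seq_def by blast
    qed
    have X: "uea_incl L (X_bar m n (\<sigma> (I ! (2 * a))) (\<sigma> (I ! (2 * a + 1))))
        = uea_class L (wedge (bvec (\<sigma> (I ! (2 * a)))) (bvec (\<sigma> (I ! (2 * a + 1)))))" if "a < p" for a
    proof -
      have "\<sigma> (I ! (2 * a)) < \<sigma> (I ! (2 * a + 1))"
        using \<sigma> that by (simp add: P_plus_def)
      then show ?thesis
        using range[of "2 * a"] range[of "2 * a + 1"] that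
        by (simp add: uea_incl_def wedge_def X_bar_eq_omega)
    qed
    have "W_prod m n p I \<sigma> = foldr (\<lambda>a u. uea_class L (wedge (bvec (\<sigma> (I ! (2 * a))))
        (bvec (\<sigma> (I ! (2 * a + 1))))) \<otimes>\<^bsub>uea L\<^esub> u) [0..<p] \<one>\<^bsub>uea L\<^esub>"
      unfolding W_prod_def by (rule foldr_cong[OF refl refl], subst X) auto
    also have "\<dots> = uea_class L (pair_prod p (\<lambda>j. bvec (\<sigma> (I ! j)))) \<otimes>\<^bsub>uea L\<^esub> \<one>\<^bsub>uea L\<^esub>"
      using foldr_wedge[OF U.one_closed, of "\<lambda>j. bvec (\<sigma> (I ! j))" p] by simp
    finally show ?thesis by (simp add: class_hom.hom_closed)
  qed
  have "W_elem m n p I = (\<Oplus>\<^bsub>uea L\<^esub> \<sigma> \<in> P_plus p I.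
      uea_class L (scalar (of_int (sign \<sigma>)) * pair_prod p (\<lambda>j. bvec (\<sigma> (I ! j)))))"
    unfolding W_elem_def
    by (rule U.finsum_cong'[OF refl])
      (auto simp: prod uea_smult_class intro!: class_hom.hom_closed free_alg_mult)
  also have "\<dots> = uea_class L (W_rep p I)"
    unfolding W_rep_def by (rule uea_class_finsum) (auto intro: free_alg_mult)
  finally show ?thesis .
qed

section \<open>Invariance of the span\<close>

text \<open>Membership in the sum of the lines \<open>\<complex> W\<^sub>I\<close>, expressed on representatives.\<close>

definition in_span :: "nat \<Rightarrow> complex mat free_poly \<Rightarrow> bool" where
  "in_span p x \<longleftrightarrow> (\<exists>c. x \<approx>\<^sub>U (\<Sum>I\<in>T_seq (2 * p) N. scalar (c I) * W_rep p I))"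

lemma in_span_cong: "x \<approx>\<^sub>U y \<Longrightarrow> in_span p y \<Longrightarrow> in_span p x"
  unfolding in_span_def using ucong_trans by blast

lemma in_span_zero: "in_span p 0"
  unfolding in_span_def by (rule exI[of _ "\<lambda>_. 0"]) (simp add: ucong_refl)

lemma in_span_add:
  assumes "in_span p x" "in_span p y" shows "in_span p (x + y)"
proof -
  from assms obtain c d where "x \<approx>\<^sub>U (\<Sum>I\<in>T_seq (2 * p) N. scalar (c I) * W_rep p I)"
    "y \<approx>\<^sub>U (\<Sum>I\<in>T_seq (2 * p) N. scalar (d I) * W_rep p I)"
    unfolding in_span_def by blast
  from ucong_add[OF this] show ?thesis
    unfolding in_span_def
    by (intro exI[of _ "\<lambda>I. c I + d I"]) (simp add: scalar_add distrib_right sum.distrib)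
qed

lemma in_span_scalar:
  assumes "in_span p x" shows "in_span p (scalar a * x)"
proof -
  from assms obtain c where "x \<approx>\<^sub>U (\<Sum>I\<in>T_seq (2 * p) N. scalar (c I) * W_rep p I)"
    unfolding in_span_def by blast
  from ucong_scalar[OF this, of a] show ?thesis
    unfolding in_span_def
    by (intro exI[of _ "\<lambda>I. a * c I"])
      (simp add: sum_distrib_left mult.assoc[symmetric] scalar_mult)
qed

lemma in_span_sum: "(\<And>i. i \<in> A \<Longrightarrow> in_span p (x i)) \<Longrightarrow> in_span p (\<Sum>i\<in>A. scalar (a i) * x i)"
  by (induction A rule: infinite_finite_induct) (auto simp: in_span_zero intro: in_span_add
      in_span_scalar)

lemma in_span_W_rep:
  assumes "I \<in> T_seq (2 * p) N" shows "in_span p (W_rep p I)"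
proof -
  have "(\<Sum>J\<in>T_seq (2 * p) N. scalar (if J = I then 1 else 0) * W_rep p J)
      = (\<Sum>J\<in>T_seq (2 * p) N. if J = I then W_rep p J else 0)"
    by (intro sum.cong) auto
  also have "\<dots> = W_rep p I" using assms by (simp add: T_seq_finite)
  finally show ?thesis
    unfolding in_span_def by (intro exI[of _ "\<lambda>J. if J = I then 1 else 0"]) (simp add: ucong_refl)
qed

lemma in_span_pfaffian_basis:
  assumes K: "\<And>j. j < 2 * p \<Longrightarrow> K j \<in> {1..N}"
  shows "in_span p (pfaffian p (basis_tuple K))"
proof (cases "inj_on K {..<2 * p}")
  case True
  obtain I \<pi> where I: "I \<in> T_seq (2 * p) N" and \<pi>: "\<pi> permutes {..<2 * p}"
    and eq: "\<And>j. j < 2 * p \<Longrightarrow> K j = I ! \<pi> j"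
    using injective_tuple_factorization[OF True K] by blast
  have "pfaffian p (basis_tuple K) = pfaffian p (basis_tuple ((!) I) \<circ> \<pi>)"
    by (rule pfaffian_cong) (simp add: basis_tuple_def eq)
  then have "pfaffian p (basis_tuple K) = scalar (of_int (sign \<pi>)) * pfaffian p (basis_tuple ((!) I))"
    by (simp add: pfaffian_permute[OF \<pi>])
  then show ?thesis
    using in_span_cong[OF pfaffian_eq_W_rep[OF I] in_span_scalar[OF in_span_W_rep[OF I]]]
        in_span_scalar
    by simp
next
  case False
  then obtain a b where "a < 2 * p" "b < 2 * p" "a \<noteq> b" "basis_tuple K a = basis_tuple K b"
    by (auto simp: inj_on_def basis_tuple_def)
  then show ?thesis by (intro in_span_cong[OF pfaffian_repeated in_span_zero])
qed

text \<open>Slots are expanded one after another: in the induction, the slots from \<open>b\<close> on already hold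
  basis vectors and the earlier ones are arbitrary.\<close>

lemma in_span_pfaffian:
  assumes "\<And>j r. j < 2 * p \<Longrightarrow> r \<ge> N \<Longrightarrow> v j r = 0"
  shows "in_span p (pfaffian p v)"
proof -
  have "in_span p (pfaffian p v)" if "b \<le> 2 * p" "\<forall>j<b. \<forall>r\<ge>N. v j r = 0"
    "\<forall>j. b \<le> j \<and> j < 2 * p \<longrightarrow> (\<exists>k\<in>{1..N}. v j = bvec k)" for b v
    using that
  proof (induction b arbitrary: v)
    case 0
    then have "\<forall>j<2 * p. \<exists>k\<in>{1..N}. v j = bvec k" by simp
    then have "\<forall>j. \<exists>k. j < 2 * p \<longrightarrow> k \<in> {1..N} \<and> v j = bvec k" by blast
    then obtain K where K: "\<And>j. j < 2 * p \<Longrightarrow> K j \<in> {1..N} \<and> v j = bvec (K j)" by metis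
    have "pfaffian p v = pfaffian p (basis_tuple K)" by (rule pfaffian_cong) (simp add: K
        basis_tuple_def)
    then show ?case using in_span_pfaffian_basis[of p K] K by simp
  next
    case (Suc b)
    define a where "a k = v b (k - 1) * basis_scale k * eta (k - 1)" for k
    have "v b = (\<lambda>r. \<Sum>k\<in>{1..N}. a k * bvec k r)"
      unfolding a_def by (rule bvec_expand) (use Suc.prems(2) in simp)
    then have "pfaffian p v = pfaffian p (v(b := \<lambda>r. \<Sum>k\<in>{1..N}. a k * bvec k r))"
      by (metis fun_upd_triv)
    also have "\<dots> \<approx>\<^sub>U (\<Sum>k\<in>{1..N}. scalar (a k) * pfaffian p (v(b := bvec k)))"
      using Suc.prems(1) by (intro pfaffian_slot_sum) auto
    finally show ?case
    proof (rule in_span_cong, intro in_span_sum)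
      fix k assume k: "k \<in> {1..N}"
      show "in_span p (pfaffian p (v(b := bvec k)))"
      proof (rule Suc.IH)
        show "b \<le> 2 * p" using Suc.prems(1) by simp
        show "\<forall>j<b. \<forall>r\<ge>N. (v(b := bvec k)) j r = 0" using Suc.prems(2) by simp
        show "\<forall>j. b \<le> j \<and> j < 2 * p \<longrightarrow> (\<exists>i\<in>{1..N}. (v(b := bvec k)) j = bvec i)"
        proof (intro allI impI)
          fix j assume j: "b \<le> j \<and> j < 2 * p"
          show "\<exists>i\<in>{1..N}. (v(b := bvec k)) j = bvec i"
          proof (cases "j = b")
            case False
            then have "Suc b \<le> j \<and> j < 2 * p" using j by simp
            then show ?thesis using Suc.prems(3) False by simp
          qed (use k in auto)
        qed
      qed
    qed
  qed
  from this[of "2 * p" v] show ?thesis using assms by simp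
qed

lemma W_space_iff: "u \<in> W_space m n p \<longleftrightarrow>
  (\<exists>c. u = uea_class L (\<Sum>I\<in>T_seq (2 * p) N. scalar (c I) * W_rep p I))"
proof -
  have line: "uea_line L (W_elem m n p I) = range (\<lambda>c. uea_class L (scalar c * W_rep p I))"
    if "I \<in> T_seq (2 * p) N" for I
    unfolding uea_line_def W_elem_eq[OF that] by (auto simp: uea_smult_class)
  have fs: "finsum (uea L) v (T_seq (2 * p) N) = uea_class L (\<Sum>I\<in>T_seq (2 * p) N. scalar (c I)
      * W_rep p I)"
    if "\<And>I. I \<in> T_seq (2 * p) N \<Longrightarrow> v I = uea_class L (scalar (c I) * W_rep p I)" for v c
  proof -
    have "finsum (uea L) v (T_seq (2 * p) N)
        = (\<Oplus>\<^bsub>uea L\<^esub> I \<in> T_seq (2 * p) N. uea_class L (scalar (c I) * W_rep p I))"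
      by (rule U.finsum_cong'[OF refl])
        (auto simp: that intro!: class_hom.hom_closed free_alg_mult)
    also have "\<dots> = uea_class L (\<Sum>I\<in>T_seq (2 * p) N. scalar (c I) * W_rep p I)"
      by (rule uea_class_finsum) (auto intro: free_alg_mult)
    finally show ?thesis .
  qed
  show ?thesis
  proof
    assume "u \<in> W_space m n p"
    then obtain v where v: "u = finsum (uea L) v (T_seq (2 * p) N)"
      "\<And>I. I \<in> T_seq (2 * p) N \<Longrightarrow> v I \<in> uea_line L (W_elem m n p I)"
      unfolding W_space_def family_sum_def by auto
    then have "\<forall>I. \<exists>c. I \<in> T_seq (2 * p) N \<longrightarrow> v I = uea_class L (scalar c * W_rep p I)"
      using line by blast
    then obtain c where "\<And>I. I \<in> T_seq (2 * p) N \<Longrightarrow> v I = uea_class L (scalar (c I) * W_rep p I)"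
      by metis
    then show "\<exists>c. u = uea_class L (\<Sum>I\<in>T_seq (2 * p) N. scalar (c I) * W_rep p I)"
      using fs v(1) by blast
  next
    assume "\<exists>c. u = uea_class L (\<Sum>I\<in>T_seq (2 * p) N. scalar (c I) * W_rep p I)"
    then obtain c where u: "u = uea_class L (\<Sum>I\<in>T_seq (2 * p) N. scalar (c I) * W_rep p I)" ..
    let ?v = "\<lambda>I. uea_class L (scalar (c I) * W_rep p I)"
    have "u = finsum (uea L) ?v (T_seq (2 * p) N)" using fs[of ?v c] u by simp
    moreover have "?v \<in> Pi (T_seq (2 * p) N) (\<lambda>I. uea_line L (W_elem m n p I))"
      using line by auto
    ultimately show "u \<in> W_space m n p"
      unfolding W_space_def family_sum_def by blast
  qed
qed

lemma W_space_in_span: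
  assumes "x \<in> C" "in_span p x" shows "uea_class L x \<in> W_space m n p"
  using assms unfolding W_space_iff in_span_def
  using uea_class_eq_iff ucong_carrier(2) by blast

lemma W_space_invariant:
  assumes g: "g \<in> O_group" and u: "u \<in> W_space m n p"
  shows "uea_Ad m n g u \<in> W_space m n p"
proof -
  obtain c where c: "u = uea_class L (\<Sum>I\<in>T_seq (2 * p) N. scalar (c I) * W_rep p I)"
    using u W_space_iff by blast
  let ?q = "\<Sum>I\<in>T_seq (2 * p) N. scalar (c I) * (scalar (1 / num_block_perms p)
      * pfaffian p (basis_tuple ((!) I)))"
  have "(\<Sum>I\<in>T_seq (2 * p) N. scalar (c I) * W_rep p I) \<approx>\<^sub>U ?q"
    by (intro ucong_sum ucong_scalar W_rep_eq_pfaffian)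
  note q = ucong_carrier[OF this] this
  then have "u = uea_class L ?q"
    using c uea_class_eq_iff by blast
  then have "uea_Ad m n g u = uea_class L (free_map (Ad g) ?q)"
    unfolding uea_Ad_def using uea_map_class[OF lie_endo_Ad[OF g] q(2)] by simp
  moreover have "in_span p (free_map (Ad g) ?q)"
    unfolding free_map_sum free_map_mult free_map_scalar free_map_pfaffian[OF g]
    by (intro in_span_sum in_span_scalar in_span_pfaffian) (simp add: app_def)
  moreover have "free_map (Ad g) ?q \<in> C"
    by (rule free_map_lie_endo_carrier[OF lie_endo_Ad[OF g] q(2)])
  ultimately show ?thesis using W_space_in_span by simp
qed

section \<open>Centrality of the sum of squares\<close>

text \<open>Tuples of \<open>2p\<close> indices, repetitions allowed; outside the \<open>2p\<close> positions they are
  \<open>undefined\<close>, which makes the set finite.\<close>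

abbreviation tuples :: "nat \<Rightarrow> (nat \<Rightarrow> nat) set" where
  "tuples p \<equiv> PiE {..<2 * p} (\<lambda>_. {1..N})"

text \<open>The sum runs over all tuples rather than over increasing ones, because replacing an entry of
  a tuple leads out of the increasing ones.\<close>

definition sq_sum :: "nat \<Rightarrow> complex mat free_poly" where
  "sq_sum p = (\<Sum>K\<in>tuples p. pfaffian p (basis_tuple K) * pfaffian p (basis_tuple K))"

lemma sq_sum_carrier: "sq_sum p \<in> C"
  unfolding sq_sum_def by (intro free_alg_sum free_alg_mult pfaffian_carrier)

lemma sq_sum_bracket:
  assumes X: "X \<in> L"
  shows "letter X * sq_sum p \<approx>\<^sub>U sq_sum p * letter X"
proof (rule ucong_of_diff_zero)
  let ?P = "\<lambda>K. pfaffian p (basis_tuple K)"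
  let ?E = "\<lambda>K K'. ?P K' * ?P K + ?P K * ?P K'"
  let ?S = "\<lambda>b. \<Sum>K\<in>tuples p. \<Sum>k\<in>{1..N}. scalar (coord X k (K b)) * ?E K (K(b := k))"
  have br: "letter X * ?P K - ?P K * letter X
      \<approx>\<^sub>U (\<Sum>b<2 * p. \<Sum>k\<in>{1..N}. scalar (coord X k (K b)) * ?P (K(b := k)))"
    if K: "K \<in> tuples p" for K
  proof -
    have "letter X * ?P K - ?P K * letter X \<approx>\<^sub>U (\<Sum>b<2 * p. pfaffian p ((basis_tuple K)(b := app X
        (basis_tuple K b))))"
      by (rule pfaffian_bracket[OF X])
    also have "\<dots> \<approx>\<^sub>U (\<Sum>b<2 * p. \<Sum>k\<in>{1..N}. scalar (coord X k (K b)) * pfaffian p ((basis_tuple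
        K)(b := bvec k)))"
    proof (rule ucong_sum)
      fix b assume b: "b \<in> {..<2 * p}"
      then have "app X (basis_tuple K b) = (\<lambda>r. \<Sum>k\<in>{1..N}. coord X k (K b) * bvec k r)"
        unfolding basis_tuple_def using K by (intro app_bvec) blast
      then show "pfaffian p ((basis_tuple K)(b := app X (basis_tuple K b)))
          \<approx>\<^sub>U (\<Sum>k\<in>{1..N}. scalar (coord X k (K b)) * pfaffian p ((basis_tuple K)(b := bvec k)))"
        using b by (simp only:) (intro pfaffian_slot_sum, auto)
    qed
    also have "\<dots> = (\<Sum>b<2 * p. \<Sum>k\<in>{1..N}. scalar (coord X k (K b)) * ?P (K(b := k)))"
    proof -
      have "(basis_tuple K)(b := bvec k) = basis_tuple (K(b := k))" for b k
        by (auto simp: basis_tuple_def fun_eq_iff)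
      then show ?thesis by simp
    qed
    finally show ?thesis .
  qed
  have split: "letter X * sq_sum p - sq_sum p * letter X = (\<Sum>K\<in>tuples p.
      (letter X * ?P K - ?P K * letter X) * ?P K + ?P K * (letter X * ?P K - ?P K * letter X))"
    unfolding sq_sum_def sum_distrib_left sum_distrib_right sum_subtractf[symmetric]
    by (intro sum.cong refl) (simp add: algebra_simps)
  have swap: "(\<Sum>K\<in>tuples p. \<Sum>b<2 * p. \<Sum>k\<in>{1..N}. scalar (coord X k (K b)) * ?E K (K(b := k)))
      = (\<Sum>b<2 * p. ?S b)"
    by (rule sum.swap)
  have expand: "letter X * sq_sum p - sq_sum p * letter X \<approx>\<^sub>U
      (\<Sum>K\<in>tuples p. \<Sum>b<2 * p. \<Sum>k\<in>{1..N}. scalar (coord X k (K b)) * ?E K (K(b := k)))"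
    unfolding split
  proof (rule ucong_sum)
    fix K assume K: "K \<in> tuples p"
    let ?D = "\<Sum>b<2 * p. \<Sum>k\<in>{1..N}. scalar (coord X k (K b)) * ?P (K(b := k))"
    have "(letter X * ?P K - ?P K * letter X) * ?P K + ?P K * (letter X * ?P K - ?P K * letter X)
        \<approx>\<^sub>U ?D * ?P K + ?P K * ?D"
      by (intro ucong_add ucong_mult[OF br[OF K] ucong_refl] ucong_mult[OF ucong_refl br[OF K]]
          pfaffian_carrier)
    also have "?D * ?P K + ?P K * ?D
        = (\<Sum>b<2 * p. \<Sum>k\<in>{1..N}. scalar (coord X k (K b)) * ?E K (K(b := k)))"
      unfolding sum_distrib_left sum_distrib_right sum.distrib[symmetric]
      by (simp only: mult.assoc mult_scalar_left distrib_left)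
    finally show "(letter X * ?P K - ?P K * letter X) * ?P K + ?P K * (letter X * ?P K - ?P K
        * letter X)
        \<approx>\<^sub>U (\<Sum>b<2 * p. \<Sum>k\<in>{1..N}. scalar (coord X k (K b)) * ?E K (K(b := k)))" .
  qed
  have cancel: "(\<Sum>b<2 * p. ?S b) \<approx>\<^sub>U (\<Sum>b<2 * p. 0)"
  proof (rule ucong_sum)
    fix b assume b: "b \<in> {..<2 * p}"
    let ?D = "tuples p \<times> {1..N}"
    \<comment> \<open>This involution exchanges the old and the new value of slot \<open>b\<close>: it preserves the
      anticommutator and reverses the sign of the coefficient.\<close>
    let ?\<phi> = "\<lambda>(K, k). (K(b := k), K b :: nat)"
    let ?h = "\<lambda>(K, k). scalar (coord X k (K b)) * ?E K (K(b := k))"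
    have upd: "K(b := k) \<in> tuples p" "K b \<in> {1..N}" if "K \<in> tuples p" "k \<in> {1..N}" for K k
    proof -
      show "K b \<in> {1..N}" by (rule PiE_mem[OF that(1) b])
      have "K(b := k) \<in> PiE (insert b {..<2 * p}) (\<lambda>_. {1..N})"
        by (rule PiE_fun_upd[OF that(2,1)])
      then show "K(b := k) \<in> tuples p" using b by (simp only: insert_absorb)
    qed
    have inv: "?\<phi> (?\<phi> x) = x" for x by (cases x) simp
    have maps: "?\<phi> ` ?D \<subseteq> ?D"
    proof (rule image_subsetI)
      fix x assume x: "x \<in> ?D"
      obtain K k where Kk: "x = (K, k)" by (cases x)
      then have K: "K \<in> tuples p" and k: "k \<in> {1..N}" using x by simp_all
      show "?\<phi> x \<in> ?D"
        unfolding Kk prod.case by (rule SigmaI[OF upd[OF K k]])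
    qed
    have "bij_betw ?\<phi> ?D ?D"
      by (rule bij_betw_byWitness[where f' = ?\<phi>, OF _ _ maps maps]; intro ballI inv)
    then have "sum ?h ?D = (\<Sum>x\<in>?D. ?h (?\<phi> x))"
      by (rule sum.reindex_bij_betw[symmetric])
    also have "\<dots> = (\<Sum>x\<in>?D. - ?h x)"
    proof (rule sum.cong[OF refl])
      fix x assume x: "x \<in> ?D"
      obtain K k where Kk: "x = (K, k)" by (cases x)
      then have K: "K \<in> tuples p" and k: "k \<in> {1..N}" using x by simp_all
      have "coord X (K b) k = - coord X k (K b)"
        by (rule coord_antisym[OF X upd(2)[OF K k] k])
      then show "?h (?\<phi> x) = - ?h x"
        by (simp add: Kk scalar_uminus algebra_simps)
    qed
    also have "\<dots> = - sum ?h ?D" by (rule sum_negf)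
    finally have "sum ?h ?D = - sum ?h ?D" .
    moreover have "sum ?h ?D = ?S b" by (rule sum.cartesian_product[symmetric])
    moreover have "?S b \<in> C"
      by (intro free_alg_sum free_alg_mult free_alg_add pfaffian_carrier free_alg_scalar)
    ultimately show "?S b \<approx>\<^sub>U 0"
      using ucong_neg_self[of "?S b"] ucong_refl[of "?S b"] by simp
  qed
  show "letter X * sq_sum p - sq_sum p * letter X \<approx>\<^sub>U 0"
    using ucong_trans[OF expand[unfolded swap] cancel] by (simp only: sum.neutral_const)
  show "sq_sum p * letter X \<in> C"
    by (intro free_alg_mult sq_sum_carrier free_alg_letter X)
qed

lemma injective_tuples_bij:
  "bij_betw (\<lambda>(I, \<pi>). restrict (\<lambda>j. I ! \<pi> j) {..<2 * p})
     (T_seq (2 * p) N \<times> {\<pi>. \<pi> permutes {..<2 * p}}) {K \<in> tuples p. inj_on K {..<2 * p}}"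
proof (rule bij_betw_imageI)
  let ?f = "\<lambda>(I, \<pi>). restrict (\<lambda>j. I ! \<pi> j) {..<2 * p}"
  show "inj_on ?f (T_seq (2 * p) N \<times> {\<pi>. \<pi> permutes {..<2 * p}})"
  proof (rule inj_onI, clarify)
    fix I \<pi> J \<rho>
    assume I: "I \<in> T_seq (2 * p) N" and J: "J \<in> T_seq (2 * p) N"
      and \<pi>: "\<pi> permutes {..<2 * p}" and \<rho>: "\<rho> permutes {..<2 * p}"
      and eq: "restrict (\<lambda>j. I ! \<pi> j) {..<2 * p} = restrict (\<lambda>j. J ! \<rho> j) {..<2 * p}"
    have e: "I ! \<pi> j = J ! \<rho> j" if "j < 2 * p" for j
      using fun_cong[OF eq, of j] that by simp
    have "set I = (!) I ` \<pi> ` {..<2 * p}"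
      using T_seq_image_nth[OF I] permutes_image[OF \<pi>] by simp
    also have "\<dots> = (!) J ` \<rho> ` {..<2 * p}"
      unfolding image_image by (rule image_cong) (simp_all add: e)
    also have "\<dots> = set J"
      using T_seq_image_nth[OF J] permutes_image[OF \<rho>] by simp
    finally have IJ: "I = J" by (rule T_seq_eqI[OF I J])
    have "\<pi> j = \<rho> j" for j
    proof (cases "j < 2 * p")
      case True
      then show ?thesis
        using e[OF True] inj_onD[OF T_seq_inj_on[OF I], of "\<pi> j" "\<rho> j"] IJ
          permutes_in_image[OF \<pi>, of j] permutes_in_image[OF \<rho>, of j] by simp
    next
      case False
      then show ?thesis using permutes_not_in[OF \<pi>] permutes_not_in[OF \<rho>] by simp
    qed
    with IJ show "I = J \<and> \<pi> = \<rho>" by (simp add: fun_eq_iff)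
  qed
  show "?f ` (T_seq (2 * p) N \<times> {\<pi>. \<pi> permutes {..<2 * p}}) = {K \<in> tuples p. inj_on K {..<2 * p}}"
  proof (intro equalityI subsetI)
    fix K assume "K \<in> ?f ` (T_seq (2 * p) N \<times> {\<pi>. \<pi> permutes {..<2 * p}})"
    then obtain I \<pi> where I: "I \<in> T_seq (2 * p) N" and \<pi>: "\<pi> permutes {..<2 * p}"
      and K: "K = restrict (\<lambda>j. I ! \<pi> j) {..<2 * p}" by auto
    have lt: "\<pi> j < 2 * p" if "j < 2 * p" for j
      using permutes_in_image[OF \<pi>, of j] that by simp
    have "K \<in> tuples p"
      unfolding K by (intro restrict_PiE_iff[THEN iffD2] ballI T_seq_nth[OF I]) (simp add: lt)
    moreover have "inj_on K {..<2 * p}"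
    proof (rule inj_onI)
      fix i j assume ij: "i \<in> {..<2 * p}" "j \<in> {..<2 * p}" "K i = K j"
      then have "\<pi> i = \<pi> j"
        using inj_onD[OF T_seq_inj_on[OF I], of "\<pi> i" "\<pi> j"] lt by (simp add: K)
      then show "i = j" by (simp add: inj_eq[OF permutes_inj[OF \<pi>]])
    qed
    ultimately show "K \<in> {K \<in> tuples p. inj_on K {..<2 * p}}" by simp
  next
    fix K assume K: "K \<in> {K \<in> tuples p. inj_on K {..<2 * p}}"
    then have "K j \<in> {1..N}" if "j < 2 * p" for j using that by blast
    with K obtain I \<pi> where I: "I \<in> T_seq (2 * p) N" "\<pi> permutes {..<2 * p}"
      "\<And>j. j < 2 * p \<Longrightarrow> K j = I ! \<pi> j"
      using injective_tuple_factorization[of K "2 * p" N] by blast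
    have "K = restrict (\<lambda>j. I ! \<pi> j) {..<2 * p}"
      using K I(3) by (auto simp: fun_eq_iff restrict_def PiE_iff extensional_def)
    then show "K \<in> ?f ` (T_seq (2 * p) N \<times> {\<pi>. \<pi> permutes {..<2 * p}})"
      using I(1,2) by (intro image_eqI[of _ _ "(I, \<pi>)"]) auto
  qed
qed

text \<open>Tuples with a repeated entry contribute 0. Any other tuple is a permutation of an increasing
  sequence, and the sign of the permutation disappears in the square.\<close>

lemma sq_sum_eq:
  "sq_sum p \<approx>\<^sub>U scalar (of_nat (card {\<pi>. \<pi> permutes {..<2 * p}}) * (num_block_perms p
      * num_block_perms p)) *
    (\<Sum>I\<in>T_seq (2 * p) N. W_rep p I * W_rep p I)"
proof -
  let ?P = "\<lambda>K. pfaffian p (basis_tuple K)" and ?S = "{\<pi>. \<pi> permutes {..<2 * p}}"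
  have fin: "finite (tuples p)" by (simp add: finite_PiE)
  have "sq_sum p \<approx>\<^sub>U (\<Sum>K\<in>tuples p. if inj_on K {..<2 * p} then ?P K * ?P K else 0)"
    unfolding sq_sum_def
  proof (rule ucong_sum)
    fix K :: "nat \<Rightarrow> nat"
    show "?P K * ?P K \<approx>\<^sub>U (if inj_on K {..<2 * p} then ?P K * ?P K else 0)"
    proof (cases "inj_on K {..<2 * p}")
      case True
      then show ?thesis by (simp add: ucong_refl free_alg_mult)
    next
      case False
      then obtain a b where "a < 2 * p" "b < 2 * p" "a \<noteq> b" "basis_tuple K a = basis_tuple K b"
        by (auto simp: inj_on_def basis_tuple_def)
      then have "?P K * ?P K \<approx>\<^sub>U 0 * ?P K"
        by (intro ucong_mult[OF pfaffian_repeated ucong_refl[OF pfaffian_carrier]])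
      then show ?thesis using False by simp
    qed
  qed
  also have "\<dots> = (\<Sum>K | K \<in> tuples p \<and> inj_on K {..<2 * p}. ?P K * ?P K)"
    by (rule sum.inter_filter[OF fin, symmetric])
  also have "\<dots> = (\<Sum>(I, \<pi>)\<in>T_seq (2 * p) N \<times> ?S. ?P ((!) I) * ?P ((!) I))"
    unfolding sum.reindex_bij_betw[OF injective_tuples_bij, symmetric]
  proof (intro sum.cong refl, clarify)
    fix I \<pi> assume \<pi>: "\<pi> permutes {..<2 * p}"
    have "?P (restrict (\<lambda>j. I ! \<pi> j) {..<2 * p}) = pfaffian p (basis_tuple ((!) I) \<circ> \<pi>)"
      by (rule pfaffian_cong) (simp add: basis_tuple_def)
    also have "\<dots> = scalar (of_int (sign \<pi>)) * ?P ((!) I)" by (rule pfaffian_permute[OF \<pi>])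
    finally have e: "?P (restrict (\<lambda>j. I ! \<pi> j) {..<2 * p}) = scalar (of_int (sign \<pi>)) * ?P ((!) I)" .
    have "of_int (sign \<pi>) * of_int (sign \<pi>) = (1 :: complex)" by (simp add: sign_def)
    then show "?P (restrict (\<lambda>j. I ! \<pi> j) {..<2 * p}) * ?P (restrict (\<lambda>j. I ! \<pi> j) {..<2 * p})
        = ?P ((!) I) * ?P ((!) I)"
      unfolding e scalar_mult_both by simp
  qed
  also have "\<dots> = scalar (of_nat (card ?S)) * (\<Sum>I\<in>T_seq (2 * p) N. ?P ((!) I) * ?P ((!) I))"
    by (simp add: sum.cartesian_product[symmetric] scalar_of_nat sum_distrib_left)
  also have "\<dots> \<approx>\<^sub>U scalar (of_nat (card ?S)) *
      (\<Sum>I\<in>T_seq (2 * p) N. (scalar (num_block_perms p) * W_rep p I) * (scalar (num_block_perms p)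
          * W_rep p I))"
    by (intro ucong_scalar ucong_sum ucong_mult pfaffian_eq_W_rep)
  also have "\<dots> = scalar (of_nat (card ?S) * (num_block_perms p * num_block_perms p))
      * (\<Sum>I\<in>T_seq (2 * p) N. W_rep p I * W_rep p I)"
  proof -
    have e: "(scalar (num_block_perms p) * W_rep p I) * (scalar (num_block_perms p) * W_rep p I)
        = scalar (num_block_perms p * num_block_perms p) * (W_rep p I * W_rep p I)" for I
      by (rule scalar_mult_both)
    show ?thesis
      unfolding e sum_distrib_left[symmetric] mult.assoc[of "scalar _" "scalar _", symmetric]
          scalar_mult ..
  qed
  finally show ?thesis .
qed

lemma W_sum_central: "W_sum m n p \<in> ring_center (uea L)"
proof -
  let ?Z = "\<Sum>I\<in>T_seq (2 * p) N. W_rep p I * W_rep p I"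
  let ?d = "of_nat (card {\<pi>. \<pi> permutes {..<2 * p}}) * (num_block_perms p * num_block_perms p)"
  have ZC: "?Z \<in> C" by (intro free_alg_sum free_alg_mult W_rep_carrier)
  have d: "?d \<noteq> 0"
    using num_block_perms_nonzero[of p] by (simp add: card_permutations[OF refl])
  have Z: "?Z \<approx>\<^sub>U scalar (1 / ?d) * sq_sum p"
  proof -
    have "scalar (1 / ?d) * (scalar ?d * ?Z) = ?Z"
      using d by (simp only: mult.assoc[symmetric] scalar_mult) simp
    then show ?thesis
      using ucong_sym[OF ucong_scalar[OF sq_sum_eq, of "1 / ?d" p]] by simp
  qed
  have comm: "letter X * ?Z \<approx>\<^sub>U ?Z * letter X" if X: "X \<in> L" for X
  proof -
    have lC: "letter X \<in> C" using X by (rule free_alg_letter)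
    have "letter X * ?Z \<approx>\<^sub>U letter X * (scalar (1 / ?d) * sq_sum p)"
      by (rule ucong_mult[OF ucong_refl[OF lC] Z])
    also have "\<dots> = scalar (1 / ?d) * (letter X * sq_sum p)" by (rule mult_scalar_left)
    also have "\<dots> \<approx>\<^sub>U scalar (1 / ?d) * (sq_sum p * letter X)"
      by (rule ucong_scalar[OF sq_sum_bracket[OF X]])
    also have "\<dots> = (scalar (1 / ?d) * sq_sum p) * letter X" by (simp only: mult.assoc)
    also have "\<dots> \<approx>\<^sub>U ?Z * letter X"
      by (rule ucong_mult[OF ucong_sym[OF Z] ucong_refl[OF lC]])
    finally show ?thesis .
  qed
  have "W_sum m n p = (\<Oplus>\<^bsub>uea L\<^esub> I \<in> T_seq (2 * p) N. uea_class L (W_rep p I * W_rep p I))"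
    unfolding W_sum_def
    by (rule U.finsum_cong'[OF refl])
      (auto simp: W_elem_eq uea_class_mult intro!: class_hom.hom_closed free_alg_mult)
  also have "\<dots> = uea_class L ?Z"
    by (rule uea_class_finsum) (auto intro: free_alg_mult)
  finally have W: "W_sum m n p = uea_class L ?Z" .
  show ?thesis
    unfolding ring_center_def W
  proof (intro CollectI conjI ballI)
    show "uea_class L ?Z \<in> carrier (uea L)" using ZC by (rule class_hom.hom_closed)
    fix u assume "u \<in> carrier (uea L)"
    then obtain q where q: "q \<in> C" "u = uea_class L q" by (rule uea_carrierE)
    have "q * ?Z \<approx>\<^sub>U ?Z * q"
      by (rule commutes_if_commutes_letters[OF ZC comm q(1)])
    then have "uea_class L (q * ?Z) = uea_class L (?Z * q)"
      by (rule uea_class_cong)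
    then show "uea_class L ?Z \<otimes>\<^bsub>uea L\<^esub> u = u \<otimes>\<^bsub>uea L\<^esub> uea_class L ?Z"
      using q ZC by (simp add: uea_class_mult)
  qed
qed

section \<open>Independence of the lines\<close>

text \<open>The reflection in the coordinate number \<open>i\<close>, counted from 1; the identity if there is no such
  coordinate.\<close>

definition refl_mat :: "nat \<Rightarrow> real mat" where
  "refl_mat i = mat_diag N (\<lambda>k. if Suc k = i then - 1 else 1)"

lemma refl_mat_O_group: "refl_mat i \<in> O_group"
proof -
  have "transpose_mat (refl_mat i) = refl_mat i"
    by (intro eq_matI) (auto simp: refl_mat_def mat_diag_def)
  moreover have "refl_mat i * I_form m n * refl_mat i = I_form m n"
    unfolding refl_mat_def I_form_def mat_diag_diag
    by (intro arg_cong[of _ _ "mat_diag N"]) auto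
  ultimately show ?thesis by (simp add: O_group_def refl_mat_def)
qed

lemma app_refl_mat:
  assumes "k \<in> {1..N}"
  shows "app (cmat (refl_mat i)) (bvec k) = (\<lambda>r. (if k = i then - 1 else 1) * bvec k r)"
proof
  fix r
  have "app (cmat (refl_mat i)) (bvec k) r
      = (if r < N then \<Sum>l<N. if l = r then (if Suc r = i then - 1 else 1) * bvec k r else 0 else 0)"
    unfolding app_def
    by (intro if_cong refl sum.cong) (auto simp: refl_mat_def mat_diag_def)
  also have "\<dots> = (if k = i then - 1 else 1) * bvec k r"
    using assms by (auto simp: bvec_def)
  finally show "app (cmat (refl_mat i)) (bvec k) r = (if k = i then - 1 else 1) * bvec k r" .
qed

text \<open>The reflection negates the basis vector number \<open>i\<close>, which fills at most one slot of the
  Pfaffian of \<open>I\<close>, and fixes the others.\<close>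

lemma reflection_W_rep:
  assumes I: "I \<in> T_seq (2 * p) N"
  shows "free_map (Ad (refl_mat i)) (W_rep p I) \<approx>\<^sub>U (if i \<in> set I then - W_rep p I else W_rep p I)"
proof -
  let ?v = "\<lambda>j. app (cmat (refl_mat i)) (basis_tuple ((!) I) j)" and ?s = "if i \<in> set I then
      - 1 else 1 :: complex"
  note g = refl_mat_O_group[of i]
  have v: "?v j = (\<lambda>r. (if I ! j = i then - 1 else 1) * bvec (I ! j) r)" if "j < 2 * p" for j
    unfolding basis_tuple_def by (rule app_refl_mat[OF T_seq_nth[OF I that]])
  have pfaffian: "pfaffian p ?v \<approx>\<^sub>U scalar ?s * pfaffian p (basis_tuple ((!) I))"
  proof (cases "i \<in> set I")
    case False
    have "pfaffian p ?v = pfaffian p (basis_tuple ((!) I))"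
    proof (rule pfaffian_cong)
      fix j assume j: "j < 2 * p"
      then have "I ! j \<in> set I" using I by (simp add: T_seq_def)
      then have "I ! j \<noteq> i" using False by blast
      then show "?v j = basis_tuple ((!) I) j" unfolding v[OF j] by (simp add: basis_tuple_def)
    qed
    then show ?thesis using False by (simp add: ucong_refl)
  next
    case True
    then have "i \<in> (!) I ` {..<2 * p}" unfolding T_seq_image_nth[OF I] .
    then obtain b where b: "b < 2 * p" "I ! b = i" by auto
    have "pfaffian p ?v = pfaffian p ((basis_tuple ((!) I))(b := \<lambda>r. \<Sum>k\<in>{i}. - 1 * bvec k r))"
    proof (rule pfaffian_cong)
      fix j assume j: "j < 2 * p"
      show "?v j = ((basis_tuple ((!) I))(b := \<lambda>r. \<Sum>k\<in>{i}. - 1 * bvec k r)) j"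
      proof (cases "j = b")
        case True
        then show ?thesis unfolding v[OF j] using b by simp
      next
        case False
        then have "I ! j \<noteq> i"
          using inj_onD[OF T_seq_inj_on[OF I], of j b] b j by auto
        then show ?thesis unfolding v[OF j] using False by (simp add: basis_tuple_def)
      qed
    qed
    also have "\<dots> \<approx>\<^sub>U (\<Sum>k\<in>{i}. scalar (- 1) * pfaffian p ((basis_tuple ((!) I))(b := bvec k)))"
      using b by (intro pfaffian_slot_sum) auto
    also have "\<dots> = scalar ?s * pfaffian p (basis_tuple ((!) I))"
    proof -
      have "(basis_tuple ((!) I))(b := bvec i) = basis_tuple ((!) I)"
        using b by (auto simp: basis_tuple_def fun_eq_iff)
      then show ?thesis using True by simp
    qed
    finally show ?thesis .
  qed
  have "free_map (Ad (refl_mat i)) (W_rep p I)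
      \<approx>\<^sub>U free_map (Ad (refl_mat i)) (scalar (1 / num_block_perms p) * pfaffian p (basis_tuple
          ((!) I)))"
    by (rule free_map_ucong[OF lie_endo_Ad[OF g] W_rep_eq_pfaffian[OF I]])
  also have "\<dots> = scalar (1 / num_block_perms p) * pfaffian p ?v"
    by (simp add: free_map_mult free_map_pfaffian[OF g])
  also have "\<dots> \<approx>\<^sub>U scalar (1 / num_block_perms p) * (scalar ?s * pfaffian p (basis_tuple ((!) I)))"
    by (rule ucong_scalar[OF pfaffian])
  also have "\<dots> = scalar ?s * (scalar (1 / num_block_perms p) * pfaffian p (basis_tuple ((!) I)))"
      by (rule mult_scalar_left)
  also have "\<dots> \<approx>\<^sub>U scalar ?s * W_rep p I"
    by (rule ucong_scalar[OF ucong_sym[OF W_rep_eq_pfaffian[OF I]]])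
  also have "\<dots> = (if i \<in> set I then - W_rep p I else W_rep p I)"
    by (simp add: scalar_uminus)
  finally show ?thesis .
qed

text \<open>Each reflection splits a vanishing sum into two vanishing sums, over the \<open>I\<close> that contain \<open>i\<close>
  and over those that do not. Doing this for all \<open>i\<close> isolates the summand of a single \<open>I\<close>.\<close>

lemma W_lines_independent:
  assumes sum: "(\<Sum>I\<in>T_seq (2 * p) N. scalar (c I) * W_rep p I) \<approx>\<^sub>U 0"
    and I0: "I0 \<in> T_seq (2 * p) N"
  shows "scalar (c I0) * W_rep p I0 \<approx>\<^sub>U 0"
proof -
  let ?T = "T_seq (2 * p) N" and ?x = "\<lambda>I. scalar (c I) * W_rep p I"
  have fin: "finite ?T" by (rule T_seq_finite)
  have "(\<Sum>I | I \<in> ?T \<and> set I \<inter> A = B. ?x I) \<approx>\<^sub>U 0" if "finite A" "B \<subseteq> A" for A B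
    using that
  proof (induction A arbitrary: B rule: finite_induct)
    case empty
    then show ?case using sum by simp
  next
    case (insert i A)
    let ?U = "{I \<in> ?T. set I \<inter> A = B - {i}}"
    let ?p = "\<Sum>I | I \<in> ?U \<and> i \<notin> set I. ?x I" and ?m = "\<Sum>I | I \<in> ?U \<and> i \<in> set I. ?x I"
    have finU: "finite ?U" using fin by simp
    have split: "(\<Sum>I\<in>?U. h I) = (\<Sum>I | I \<in> ?U \<and> i \<notin> set I. h I) + (\<Sum>I | I \<in> ?U \<and> i \<in> set I. h I)"
      for h :: "nat list \<Rightarrow> complex mat free_poly"
    proof -
      have "sum h ?U = sum h ({I. I \<in> ?U \<and> i \<notin> set I} \<union> {I. I \<in> ?U \<and> i \<in> set I})"
        by (rule arg_cong[where f = "sum h"]) blast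
      also have "\<dots> = (\<Sum>I | I \<in> ?U \<and> i \<notin> set I. h I) + (\<Sum>I | I \<in> ?U \<and> i \<in> set I. h I)"
        by (rule sum.union_disjoint) (rule finite_subset[OF _ finU], blast, rule finite_subset[OF
            _ finU], blast, blast)
      finally show ?thesis .
    qed
    have zero: "?p + ?m \<approx>\<^sub>U 0"
      using insert.IH[of "B - {i}"] insert.prems unfolding split[symmetric] by blast
    have C: "?p \<in> C" "?m \<in> C" by (intro free_alg_sum free_alg_mult free_alg_scalar W_rep_carrier)+
    let ?f = "free_map (Ad (refl_mat i))"
    have f: "?f (?x I) \<approx>\<^sub>U scalar (c I) * (if i \<in> set I then - W_rep p I else W_rep p I)" if "I
        \<in> ?T" for I
      unfolding free_map_mult free_map_scalar by (rule ucong_scalar[OF reflection_W_rep[OF that]])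
    have "?f ?p \<approx>\<^sub>U ?p"
      unfolding free_map_sum by (rule ucong_sum) (use f in force)
    moreover have "?f ?m \<approx>\<^sub>U - ?m"
      unfolding free_map_sum sum_negf[symmetric] by (rule ucong_sum) (use f in force)
    ultimately have act: "?f (?p + ?m) \<approx>\<^sub>U ?p + - ?m"
      unfolding free_map_add by (rule ucong_add)
    have "?f (?p + ?m) \<approx>\<^sub>U 0"
      using free_map_ucong[OF lie_endo_Ad[OF refl_mat_O_group] zero] unfolding free_map_zero .
    then have "?p + - ?m \<approx>\<^sub>U 0" by (rule ucong_trans[OF ucong_sym[OF act]])
    note p = ucong_zero_of_sum_diff(1)[OF C zero this] and m = ucong_zero_of_sum_diff(2)[OF C zero
        this]
    show ?case
    proof (cases "i \<in> B")
      case True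
      then have "{I. I \<in> ?T \<and> set I \<inter> insert i A = B} = {I. I \<in> ?U \<and> i \<in> set I}"
        using insert.hyps(2) insert.prems by blast
      then show ?thesis using m by (simp only:)
    next
      case False
      then have "{I. I \<in> ?T \<and> set I \<inter> insert i A = B} = {I. I \<in> ?U \<and> i \<notin> set I}"
        using insert.hyps(2) insert.prems by blast
      then show ?thesis using p by (simp only:)
    qed
  qed
  from this[of "{1..N}" "set I0"] have "(\<Sum>I | I \<in> ?T \<and> set I \<inter> {1..N} = set I0. ?x I) \<approx>\<^sub>U 0"
    using I0 by (simp add: T_seq_def)
  moreover have "{I. I \<in> ?T \<and> set I \<inter> {1..N} = set I0} = {I0}"
  proof (intro equalityI subsetI)
    fix I assume I: "I \<in> {I. I \<in> ?T \<and> set I \<inter> {1..N} = set I0}"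
    then have "set I \<subseteq> {1..N}" by (simp add: T_seq_def)
    then have "set I = set I0" using I by blast
    then show "I \<in> {I0}" using T_seq_eqI I I0 by blast
  next
    fix I assume "I \<in> {I0}"
    moreover have "set I0 \<subseteq> {1..N}" using I0 by (simp add: T_seq_def)
    ultimately show "I \<in> {I. I \<in> ?T \<and> set I \<inter> {1..N} = set I0}" using I0 by blast
  qed
  ultimately show ?thesis by simp
qed

lemma W_family_independent:
  "family_independent (uea L) (T_seq (2 * p) N) (\<lambda>I. uea_line L (W_elem m n p I))"
  unfolding family_independent_def
proof (intro ballI impI)
  let ?T = "T_seq (2 * p) N"
  fix v I0 assume v: "v \<in> Pi ?T (\<lambda>I. uea_line L (W_elem m n p I))"
    and zero: "finsum (uea L) v ?T = \<zero>\<^bsub>uea L\<^esub>" and I0: "I0 \<in> ?T"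
  have "\<forall>I. \<exists>c. I \<in> ?T \<longrightarrow> v I = uea_class L (scalar c * W_rep p I)"
  proof
    fix I
    show "\<exists>c. I \<in> ?T \<longrightarrow> v I = uea_class L (scalar c * W_rep p I)"
    proof (cases "I \<in> ?T")
      case True
      have "v I \<in> uea_line L (uea_class L (W_rep p I))"
        using Pi_mem[OF v True] unfolding W_elem_eq[OF True] .
      then show ?thesis by (auto simp: uea_line_def uea_smult_class)
    qed simp
  qed
  then obtain c where c: "\<And>I. I \<in> ?T \<Longrightarrow> v I = uea_class L (scalar (c I) * W_rep p I)" by metis
  let ?x = "\<lambda>I. scalar (c I) * W_rep p I"
  have C: "?x I \<in> C" for I by (intro free_alg_mult) auto
  have "finsum (uea L) v ?T = (\<Oplus>\<^bsub>uea L\<^esub> I \<in> ?T. uea_class L (?x I))"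
    by (rule U.finsum_cong'[OF refl]) (auto simp: c intro!: class_hom.hom_closed C)
  also have "\<dots> = uea_class L (\<Sum>I\<in>?T. ?x I)"
    by (rule uea_class_finsum[OF C])
  finally have eq: "uea_class L (\<Sum>I\<in>?T. ?x I) = uea_class L 0"
    using zero by (simp add: uea_class_zero)
  have "(\<Sum>I\<in>?T. ?x I) \<in> C" by (rule free_alg_sum) (rule C)
  from uea_class_eq_iff[OF this free_alg_zero, THEN iffD1, OF eq]
  have "(\<Sum>I\<in>?T. ?x I) \<approx>\<^sub>U 0" .
  from W_lines_independent[OF this I0] have "uea_class L (?x I0) = uea_class L 0"
    by (rule uea_class_cong)
  then show "v I0 = \<zero>\<^bsub>uea L\<^esub>" using c[OF I0] by (simp add: uea_class_zero)
qed

end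

theorem theorem5:
  fixes m n p :: nat
  assumes "m \<ge> n" and "n \<ge> 1" and "p \<ge> 1" and "2 * p \<le> m + n"
  shows "family_independent (uea (so_complex m n)) (T_seq (2 * p) (m + n))
           (\<lambda>I. uea_line (so_complex m n) (W_elem m n p I))
    \<and> (\<Union>g\<in>SO_0 m n. uea_Ad m n g ` W_space m n p) \<subseteq> W_space m n p
    \<and> W_sum m n p \<in> ring_center (uea (so_complex m n))"
proof -
  interpret signature m n .
  show ?thesis
    using W_family_independent W_space_invariant W_sum_central SO_0_subset_O_group by blast
qed

end
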